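(* Let $\Gamma$ be a countable group acting by $C^r$ diffeomorphisms on a compact manifold $M$. Assume the action preserves a rigid geometric structure $\omega$ of order $r$ on $M$. Then $\mathrm{Aut}^r(M,\Gamma)$ consists only of equivariant maps, i.e. for every $f\in\mathrm{Aut}^r(M,\Gamma)$ there is an automorphism $\varphi$ of $\Gamma$ with $f(\gamma x)=\varphi(\gamma)f(x)$ for all $\gamma\in\Gamma$, $x\in M$; and therefore $\mathrm{Aut}^r(M,\Gamma)=N_{\mathrm{Diff}^r(M)}(\Gamma)$, the normalizer of $\Gamma$ in $\mathrm{Diff}^r(M)$.
   Context: Manifolds are smooth; $n=\dim M$. $\Gamma$ is identified with its image in $\mathrm{Diff}^r(M)$. $\mathrm{Aut}^r(M,\Gamma)$ is the group of $C^r$ diffeomorphisms $f$ of $M$ preserving the orbit equivalence relation of $\Gamma$ ($x,y$ lie in the same $\Gamma$-orbit if and only if $f(x),f(y)$ do). Let $D^k$ be the group of $k$-jets at $0$ of diffeomorphisms of $\mathbb{R}^n$ fixing the origin, and let $P^k(M)$ be the $k$-th order frame bundle of $M$, a principal $D^k$-bundle. A geometric structure on $M$ (of order $k$) consists of a manifold $V$, an action of $D^k$ on $V$, and a continuous $D^k$-equivariant map $\omega:P^k(M)\to V$; it is denoted by $\omega$. For $r\ge k$, a $C^r$ diffeomorphism $g$ of $M$ acts on $P^r(M)$ and $P^k(M)$, and $g$ preserves $\omega$ if $\omega\circ g^{k}=\omega$, where $g^{k}:P^k(M)\to P^k(M)$ is the induced map. $\mathrm{Aut}^r(\omega)$ denotes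 the group of $C^r$ diffeomorphisms of $M$ preserving $\omega$ (with the $C^r$ topology). The action of $\Gamma$ preserves $\omega$ if every element of $\Gamma$ acts by an element of $\mathrm{Aut}^r(\omega)$. The geometric structure $\omega$ is rigid of order $r$ if the action of $\mathrm{Aut}^r(\omega)$ on $P^r(M)$ is free and proper. *)

theory Defs
  imports "HOL-Analysis.Analysis" "HOL-Algebra.Group_Action"
begin

text \<open>
  Since dimensions are arbitrary natural numbers (zero included), \<open>\<real>\<^sup>n\<close> is the library's
  \<^const>\<open>Euclidean_space\<close> \<open>n\<close>, whose points are the sequences \<open>x :: nat \<Rightarrow> real\<close> with \<open>x i = 0\<close>
  for \<open>i \<ge> n\<close>.
\<close>

section \<open>Functions of class \<open>C\<^sup>k\<close> on open subsets of \<open>\<real>\<^sup>n\<close>, and jets\<close>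

definition partial :: "nat \<Rightarrow> ((nat \<Rightarrow> real) \<Rightarrow> real) \<Rightarrow> (nat \<Rightarrow> real) \<Rightarrow> real" where
  "partial i f x = deriv (\<lambda>t. f (x(i := t))) (x i)"

text \<open>\<open>partials [i\<^sub>1, \<dots>, i\<^sub>j] f\<close> is the iterated partial derivative
  \<open>\<partial>\<^bsub>i\<^sub>1\<^esub> \<dots> \<partial>\<^bsub>i\<^sub>j\<^esub> f\<close>; the empty list gives \<open>f\<close> itself.\<close>

definition partials :: "nat list \<Rightarrow> ((nat \<Rightarrow> real) \<Rightarrow> real) \<Rightarrow> (nat \<Rightarrow> real) \<Rightarrow> real" where
  "partials is f = foldr partial is f"

text \<open>\<open>Ck n k f S\<close> is used for \<open>S\<close> open in \<open>\<real>\<^sup>n\<close>.\<close>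

primrec Ck :: "nat \<Rightarrow> nat \<Rightarrow> ((nat \<Rightarrow> real) \<Rightarrow> real) \<Rightarrow> (nat \<Rightarrow> real) set \<Rightarrow> bool" where
  "Ck n 0 f S \<longleftrightarrow> continuous_map (subtopology (Euclidean_space n) S) euclideanreal f"
| "Ck n (Suc k) f S \<longleftrightarrow>
     continuous_map (subtopology (Euclidean_space n) S) euclideanreal f \<and>
     (\<forall>i<n. (\<forall>x\<in>S. (\<lambda>t. f (x(i := t))) field_differentiable (at (x i))) \<and>
            Ck n k (partial i f) S)"

text \<open>The \<open>k\<close>-jet at \<open>x\<close> of a map \<open>F\<close> from a neighbourhood of \<open>x \<in> \<real>\<^sup>n\<close> to \<open>\<real>\<^sup>n\<close>: the family
  of all partial derivatives of its components of order at most \<open>k\<close> (order \<open>0\<close> included). All other entries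
  are set to \<open>0\<close>, so that the product topology on the type of jets restricts to the usual topology
  on \<open>k\<close>-jets.\<close>

definition jet ::
  "nat \<Rightarrow> nat \<Rightarrow> ((nat \<Rightarrow> real) \<Rightarrow> (nat \<Rightarrow> real)) \<Rightarrow> (nat \<Rightarrow> real) \<Rightarrow> (nat list \<Rightarrow> nat \<Rightarrow> real)" where
  "jet n k F x = (\<lambda>is a. if length is \<le> k \<and> set is \<subseteq> {..<n} \<and> a < n
                         then partials is (\<lambda>y. F y a) x else 0)"


section \<open>Smooth manifolds and \<open>C\<^sup>k\<close> maps\<close>

text \<open>A chart is a pair of an open set and a coordinate map, whose values outside the open set are
  irrelevant.\<close>

record 'a manifold =
  mtop :: "'a topology"
  mdim :: nat
  charts :: "('a set \<times> ('a \<Rightarrow> nat \<Rightarrow> real)) set"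

abbreviation mpoints :: "'a manifold \<Rightarrow> 'a set" where
  "mpoints M \<equiv> topspace (mtop M)"

definition smooth_manifold :: "'a manifold \<Rightarrow> bool" where
  "smooth_manifold M \<longleftrightarrow>
     Hausdorff_space (mtop M) \<and> second_countable (mtop M) \<and>
     (\<forall>(U, c) \<in> charts M.
        openin (mtop M) U \<and> openin (Euclidean_space (mdim M)) (c ` U) \<and>
        homeomorphic_map (subtopology (mtop M) U)
          (subtopology (Euclidean_space (mdim M)) (c ` U)) c) \<and>
     (\<Union>(U, c) \<in> charts M. U) = mpoints M \<and>
     (\<forall>(U, c) \<in> charts M. \<forall>(U', c') \<in> charts M. \<forall>a<mdim M. \<forall>k.
        Ck (mdim M) k (\<lambda>y. c' (inv_into U c y) a) (c ` (U \<inter> U')))"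

definition Rn :: "nat \<Rightarrow> (nat \<Rightarrow> real) manifold" where
  "Rn n = \<lparr>mtop = Euclidean_space n, mdim = n,
           charts = {(topspace (Euclidean_space n), \<lambda>x. x)}\<rparr>"

definition Ck_map ::
  "nat \<Rightarrow> 'a manifold \<Rightarrow> 'a set \<Rightarrow> 'b manifold \<Rightarrow> ('a \<Rightarrow> 'b) \<Rightarrow> bool" where
  "Ck_map k M S N f \<longleftrightarrow>
     openin (mtop M) S \<and> continuous_map (subtopology (mtop M) S) (mtop N) f \<and>
     (\<forall>(U, c) \<in> charts M. \<forall>(U', c') \<in> charts N. \<forall>a<mdim N.
        Ck (mdim M) k (\<lambda>y. c' (f (inv_into U c y)) a) (c ` {x \<in> U \<inter> S. f x \<in> U'}))"

definition Ck_diffeo ::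
  "nat \<Rightarrow> 'a manifold \<Rightarrow> 'a set \<Rightarrow> 'b manifold \<Rightarrow> 'b set \<Rightarrow> ('a \<Rightarrow> 'b) \<Rightarrow> bool" where
  "Ck_diffeo k M S N S' f \<longleftrightarrow>
     bij_betw f S S' \<and> Ck_map k M S N f \<and> Ck_map k N S' M (inv_into S f)"

text \<open>The elements of \<open>Diff\<^sup>r(M)\<close> are represented by extensional functions, as in the library's
  group \<^const>\<open>BijGroup\<close> of bijections of a set, of which \<open>Diff\<^sup>r(M)\<close> is a subgroup.\<close>

definition Diff :: "nat \<Rightarrow> 'a manifold \<Rightarrow> ('a \<Rightarrow> 'a) set" where
  "Diff r M = {f \<in> Bij (mpoints M). Ck_diffeo r M (mpoints M) M (mpoints M) f}"

definition Diff_group :: "nat \<Rightarrow> 'a manifold \<Rightarrow> ('a \<Rightarrow> 'a) monoid" where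
  "Diff_group r M = (BijGroup (mpoints M))\<lparr>carrier := Diff r M\<rparr>"

text \<open>The \<open>C\<^sup>r\<close> topology on \<open>Diff\<^sup>r(M)\<close> (for compact \<open>M\<close>): uniform convergence on compact subsets
  of charts of all partial derivatives of order at most \<open>r\<close>.\<close>

definition Cr_nbhd ::
  "nat \<Rightarrow> 'a manifold \<Rightarrow> ('a \<Rightarrow> 'a) \<Rightarrow> 'a set \<times> ('a \<Rightarrow> nat \<Rightarrow> real) \<Rightarrow>
   'a set \<times> ('a \<Rightarrow> nat \<Rightarrow> real) \<Rightarrow> 'a set \<Rightarrow> real \<Rightarrow> ('a \<Rightarrow> 'a) set" where
  "Cr_nbhd r M f = (\<lambda>(U, c) (U', c') K \<epsilon>.
     {g \<in> Diff r M. g ` K \<subseteq> U' \<and>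
        (\<forall>x\<in>K. \<forall>is a.
           \<bar>jet (mdim M) r (\<lambda>y. c' (g (inv_into U c y))) (c x) is a
            - jet (mdim M) r (\<lambda>y. c' (f (inv_into U c y))) (c x) is a\<bar> < \<epsilon>)})"

definition Cr_topology :: "nat \<Rightarrow> 'a manifold \<Rightarrow> ('a \<Rightarrow> 'a) topology" where
  "Cr_topology r M = topology_generated_by (insert (Diff r M)
     {Cr_nbhd r M f (U, c) (U', c') K \<epsilon> | f U c U' c' K \<epsilon>.
        f \<in> Diff r M \<and> (U, c) \<in> charts M \<and> (U', c') \<in> charts M \<and>
        compactin (mtop M) K \<and> K \<subseteq> U \<and> f ` K \<subseteq> U' \<and> \<epsilon> > 0})"


section \<open>The jet group \<open>D\<^sup>k\<close> and the frame bundle \<open>P\<^sup>k(M)\<close>\<close>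

abbreviation origin :: "nat \<Rightarrow> real" where
  "origin \<equiv> (\<lambda>_. 0)"

definition origin_diffeos :: "nat \<Rightarrow> ((nat \<Rightarrow> real) \<Rightarrow> (nat \<Rightarrow> real)) set" where
  "origin_diffeos n =
     {f. (\<forall>j. Ck_diffeo j (Rn n) (mpoints (Rn n)) (Rn n) (mpoints (Rn n)) f) \<and> f origin = origin}"

definition origin_jet_rel ::
  "nat \<Rightarrow> nat \<Rightarrow> (((nat \<Rightarrow> real) \<Rightarrow> (nat \<Rightarrow> real)) \<times> ((nat \<Rightarrow> real) \<Rightarrow> (nat \<Rightarrow> real))) set" where
  "origin_jet_rel n k =
     {(f, g). f \<in> origin_diffeos n \<and> g \<in> origin_diffeos n \<and>
              jet n k f origin = jet n k g origin}"

text \<open>Jets are equivalence classes of maps. Operations on classes are the images, under the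
  equivalence relation, of the operations on representatives: such an image is a single class,
  because the operations respect equality of jets.\<close>

definition jet_group :: "nat \<Rightarrow> nat \<Rightarrow> (((nat \<Rightarrow> real) \<Rightarrow> (nat \<Rightarrow> real)) set) monoid" where
  "jet_group n k =
     \<lparr>carrier = origin_diffeos n // origin_jet_rel n k,
      mult = (\<lambda>d e. origin_jet_rel n k `` {f \<circ> g | f g. f \<in> d \<and> g \<in> e}),
      one = origin_jet_rel n k `` {\<lambda>x. x}\<rparr>"

text \<open>Frames of order \<open>k\<close> are \<open>k\<close>-jets at \<open>0\<close> of local diffeomorphisms from \<open>\<real>\<^sup>n\<close> to \<open>M\<close>. The
  representatives are taken of class \<open>C\<^sup>k\<close>, so that they can be composed with \<open>C\<^sup>r\<close>
  diffeomorphisms for \<open>r \<ge> k\<close>; every such jet is also the jet of a smooth local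
  diffeomorphism (a Taylor polynomial in a chart).\<close>

definition local_params :: "nat \<Rightarrow> 'a manifold \<Rightarrow> ((nat \<Rightarrow> real) \<Rightarrow> 'a) set" where
  "local_params k M =
     {\<phi>. \<exists>W S. origin \<in> W \<and> Ck_diffeo k (Rn (mdim M)) W M S \<phi>}"

definition frame_rel ::
  "nat \<Rightarrow> 'a manifold \<Rightarrow> (((nat \<Rightarrow> real) \<Rightarrow> 'a) \<times> ((nat \<Rightarrow> real) \<Rightarrow> 'a)) set" where
  "frame_rel k M =
     {(\<phi>, \<psi>). \<phi> \<in> local_params k M \<and> \<psi> \<in> local_params k M \<and> \<phi> origin = \<psi> origin \<and>
        (\<forall>(U, c) \<in> charts M. \<phi> origin \<in> U \<longrightarrow>
           jet (mdim M) k (c \<circ> \<phi>) origin = jet (mdim M) k (c \<circ> \<psi>) origin)}"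

definition frames :: "nat \<Rightarrow> 'a manifold \<Rightarrow> ((nat \<Rightarrow> real) \<Rightarrow> 'a) set set" where
  "frames k M = local_params k M // frame_rel k M"

text \<open>The topology of \<open>P\<^sup>k(M)\<close> is the one given by the jet coordinates over the charts of \<open>M\<close>.\<close>

definition frame_bundle :: "nat \<Rightarrow> 'a manifold \<Rightarrow> ((nat \<Rightarrow> real) \<Rightarrow> 'a) set topology" where
  "frame_bundle k M = topology_generated_by
     {{p \<in> frames k M. \<exists>\<phi>\<in>p. \<phi> origin \<in> U \<and> jet (mdim M) k (c \<circ> \<phi>) origin \<in> Q} | U c Q.
       (U, c) \<in> charts M \<and> open Q}"

definition frame_act ::
  "nat \<Rightarrow> 'a manifold \<Rightarrow> ((nat \<Rightarrow> real) \<Rightarrow> 'a) set \<Rightarrow>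
   ((nat \<Rightarrow> real) \<Rightarrow> (nat \<Rightarrow> real)) set \<Rightarrow> ((nat \<Rightarrow> real) \<Rightarrow> 'a) set" where
  "frame_act k M p d = frame_rel k M `` {\<phi> \<circ> f | \<phi> f. \<phi> \<in> p \<and> f \<in> d}"

definition prolong ::
  "nat \<Rightarrow> 'a manifold \<Rightarrow> ('a \<Rightarrow> 'a) \<Rightarrow> ((nat \<Rightarrow> real) \<Rightarrow> 'a) set \<Rightarrow> ((nat \<Rightarrow> real) \<Rightarrow> 'a) set" where
  "prolong k M g p = frame_rel k M `` {g \<circ> \<phi> | \<phi>. \<phi> \<in> p}"


section \<open>Rigid geometric structures\<close>

text \<open>\<open>D\<^sup>k\<close> acts on \<open>P\<^sup>k(M)\<close> from the right and on \<open>V\<close> from the left, so equivariance reads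
  \<open>\<omega> (p d) = d\<^sup>-\<^sup>1 \<omega> (p)\<close>. No regularity of the action on \<open>V\<close> is required.\<close>

definition geometric_structure ::
  "'a manifold \<Rightarrow> nat \<Rightarrow> 'v manifold \<Rightarrow> (((nat \<Rightarrow> real) \<Rightarrow> (nat \<Rightarrow> real)) set \<Rightarrow> 'v \<Rightarrow> 'v) \<Rightarrow>
   (((nat \<Rightarrow> real) \<Rightarrow> 'a) set \<Rightarrow> 'v) \<Rightarrow> bool" where
  "geometric_structure M k V act \<omega> \<longleftrightarrow>
     smooth_manifold V \<and> group_action (jet_group (mdim M) k) (mpoints V) act \<and>
     continuous_map (frame_bundle k M) (mtop V) \<omega> \<and>
     (\<forall>p \<in> frames k M. \<forall>d \<in> carrier (jet_group (mdim M) k).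
        \<omega> (frame_act k M p d) = act (inv\<^bsub>jet_group (mdim M) k\<^esub> d) (\<omega> p))"

definition Aut_struct ::
  "nat \<Rightarrow> 'a manifold \<Rightarrow> nat \<Rightarrow> (((nat \<Rightarrow> real) \<Rightarrow> 'a) set \<Rightarrow> 'v) \<Rightarrow> ('a \<Rightarrow> 'a) set" where
  "Aut_struct r M k \<omega> = {g \<in> Diff r M. \<forall>p \<in> frames k M. \<omega> (prolong k M g p) = \<omega> p}"

text \<open>An action of a topological group \<open>A\<close> on \<open>P\<close> is proper if \<open>A \<times> P \<rightarrow> P \<times> P\<close>,
  \<open>(g, p) \<mapsto> (g p, p)\<close>, is a proper map.\<close>

definition rigid_structure ::
  "nat \<Rightarrow> 'a manifold \<Rightarrow> nat \<Rightarrow> (((nat \<Rightarrow> real) \<Rightarrow> 'a) set \<Rightarrow> 'v) \<Rightarrow> bool" where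
  "rigid_structure r M k \<omega> \<longleftrightarrow>
     (\<forall>g \<in> Aut_struct r M k \<omega>. \<forall>p \<in> frames r M.
        prolong r M g p = p \<longrightarrow> g = \<one>\<^bsub>Diff_group r M\<^esub>) \<and>
     proper_map (prod_topology (subtopology (Cr_topology r M) (Aut_struct r M k \<omega>)) (frame_bundle r M))
       (prod_topology (frame_bundle r M) (frame_bundle r M))
       (\<lambda>(g, p). (prolong r M g p, p))"


section \<open>Automorphisms of the orbit equivalence relation\<close>

definition Aut_orbits ::
  "nat \<Rightarrow> 'a manifold \<Rightarrow> ('g, 'b) monoid_scheme \<Rightarrow> ('g \<Rightarrow> 'a \<Rightarrow> 'a) \<Rightarrow> ('a \<Rightarrow> 'a) set" where
  "Aut_orbits r M G \<rho> =
     {f \<in> Diff r M. \<forall>x \<in> mpoints M. \<forall>y \<in> mpoints M.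
        y \<in> orbit G \<rho> x \<longleftrightarrow> f y \<in> orbit G \<rho> (f x)}"

end

theory Submission
  imports Defs
begin

text \<open>
  Let \<open>g = f \<gamma> f\<inverse>\<close> with \<open>f \<in> Aut\<^sup>r(M, \<Gamma>)\<close>. Then \<open>g x \<in> \<Gamma> x\<close> for all \<open>x\<close>, so by Baire's theorem \<open>g\<close>
  coincides with elements of \<open>\<Gamma>\<close> on open sets whose union is dense. Moving a frame \<open>[\<phi>]\<close> along
  \<open>t \<mapsto> [y \<mapsto> \<phi> (y + t)]\<close> and using continuity of \<open>\<omega>\<close>, it follows that \<open>g\<close> preserves \<open>\<omega>\<close>
  at every frame. The same holds for \<open>\<gamma>'\<inverse> g\<close> with \<open>\<gamma>' \<in> \<Gamma>\<close> chosen to agree with \<open>g\<close> on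
  some nonempty open set; this diffeomorphism fixes an \<open>r\<close>-frame, so it is the identity by freeness,
  and \<open>g = \<gamma>' \<in> \<Gamma>\<close>.
\<close>

subsection \<open>Derivatives along curves\<close>

text \<open>The prolongation of a diffeomorphism acts on classes of parametrisations, so it must be
  known that the \<open>k\<close>-jet of \<open>g \<circ> \<phi>\<close> depends only on the
  \<open>k\<close>-jet of \<open>\<phi>\<close>. Regularity and jets are given by iterated partial
  derivatives of coordinate functions, hence the chain rule is built from continuity of partial
  derivatives alone. Agreement of \<open>g\<close> and \<open>\<gamma>\<close> at a single point
  says nothing about jets, whereas agreement on an open set makes the induced maps equal on all
  frames over it; this is why Baire's theorem is needed. Translating a parametrisation gives a
  continuous family of frames whose base points fill a neighbourhood, so it meets those open sets
  arbitrarily close to the given frame, and the Hausdorff property of \<open>V\<close> carries the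
  equality to the limit. Once conjugation by \<open>f\<close> and by its inverse both map \<Gamma>
  into itself, conjugation by \<open>f\<close> is an automorphism of \<Gamma>, and the equivariance
  of \<open>f\<close> and its membership in the normalizer are formal; conversely, normalizing
  elements permute the orbits.\<close>

lemma Euclidean_space_eq: "Euclidean_space n = top_of_set {x. \<forall>i\<ge>n. x i = 0}"
  by (simp add: Euclidean_space_def euclidean_product_topology)

lemma openin_Euclidean_space_box:
  assumes "openin (Euclidean_space n) S" and "x \<in> S"
  obtains e where "e > 0" and "\<And>y. \<forall>i\<ge>n. y i = 0 \<Longrightarrow> \<forall>i<n. \<bar>y i - x i\<bar> < e \<Longrightarrow> y \<in> S"
proof -
  obtain T where T: "openin (powertop_real UNIV) T" "S = T \<inter> {x. \<forall>i\<ge>n. x i = 0}"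
    using assms(1) unfolding Euclidean_space_def openin_subtopology by blast
  obtain X where X: "x \<in> Pi\<^sub>E UNIV X" "\<And>i. openin euclideanreal (X i)"
      "finite {i. X i \<noteq> topspace euclideanreal}" "Pi\<^sub>E UNIV X \<subseteq> T"
    using product_topology_open_contains_basis[OF T(1), of x] assms(2) T(2) by auto
  have "\<exists>e>0. \<forall>s. \<bar>s - x i\<bar> < e \<longrightarrow> s \<in> X i" for i
  proof -
    have "open (X i)" "x i \<in> X i" using X by (auto simp: PiE_iff)
    then show ?thesis by (auto simp: open_dist dist_real_def)
  qed
  then obtain d where d: "\<And>i. d i > 0" "\<And>i s. \<bar>s - x i\<bar> < d i \<Longrightarrow> s \<in> X i" by metis
  \<comment> \<open>The entry \<open>1\<close> keeps the set nonempty when \<open>n = 0\<close>.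
    Coordinates from \<open>n\<close> on are pinned to \<open>0\<close> and impose no bound.\<close>
  define e where "e = Min (insert 1 (d ` {..<n}))"
  have "e > 0" using d by (auto simp: e_def)
  moreover have "y \<in> S" if y: "\<forall>i\<ge>n. y i = 0" "\<forall>i<n. \<bar>y i - x i\<bar> < e" for y
  proof -
    have "y i \<in> X i" for i
    proof (cases "i < n")
      case True
      then have "e \<le> d i" by (auto simp: e_def)
      then show ?thesis using y True d(2) by (meson less_le_trans)
    next
      case False
      then have "y i = x i" using y assms(2) T by auto
      then show ?thesis using d by auto
    qed
    then show ?thesis using X(4) T(2) y(1) by (auto simp: PiE_iff)
  qed
  ultimately show thesis using that by blast
qed

lemma openin_Euclidean_space_tail:
  "openin (Euclidean_space n) S \<Longrightarrow> x \<in> S \<Longrightarrow> i \<ge> n \<Longrightarrow> x i = 0"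
  using openin_subset topspace_Euclidean_space by fastforce

text \<open>A partial derivative sees a function only along a coordinate line. For
  \<open>i < n\<close> an open set contains a piece of that line around each of its points, so
  partial derivatives there are determined by values inside the set.\<close>

lemma eventually_fun_upd_in_open:
  assumes "openin (Euclidean_space n) S" and "x \<in> S" and "i < n"
  shows "eventually (\<lambda>t. x(i := t) \<in> S) (nhds (x i))"
proof -
  obtain e where e: "e > 0" "\<And>y. \<forall>i\<ge>n. y i = 0 \<Longrightarrow> \<forall>i<n. \<bar>y i - x i\<bar> < e \<Longrightarrow> y \<in> S"
    using openin_Euclidean_space_box[OF assms(1,2)] by metis
  have "x(i := t) \<in> S" if "dist t (x i) < e" for t
    using that e(1) assms openin_Euclidean_space_tail[OF assms(1,2)]
    by (intro e(2)) (auto simp: dist_real_def)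
  then show ?thesis using e(1) unfolding eventually_nhds_metric by blast
qed

lemma continuous_map_Euclidean_real_iff:
  assumes "openin (Euclidean_space n) S"
  shows "continuous_map (subtopology (Euclidean_space n) S) euclideanreal f \<longleftrightarrow> continuous_on S f"
proof -
  have "S \<subseteq> {x. \<forall>i\<ge>n. x i = 0}"
    using openin_subset[OF assms] by (simp add: topspace_Euclidean_space)
  then have "{x. \<forall>i\<ge>n. x i = 0} \<inter> S = S" by blast
  then show ?thesis
    by (simp add: Euclidean_space_eq subtopology_subtopology)
qed

lemma continuous_on_Euclidean_box:
  assumes "openin (Euclidean_space n) S" and "x \<in> S" and "continuous_on S (f :: _ \<Rightarrow> real)" and "e > 0"
  obtains d where "d > 0"
    and "\<And>y. \<forall>i\<ge>n. y i = 0 \<Longrightarrow> \<forall>i<n. \<bar>y i - x i\<bar> < d \<Longrightarrow> y \<in> S \<and> \<bar>f y - f x\<bar> < e"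
proof -
  have cm: "continuous_map (subtopology (Euclidean_space n) S) euclideanreal f"
    using assms continuous_map_Euclidean_real_iff by blast
  have "openin (subtopology (Euclidean_space n) S)
      {y \<in> topspace (subtopology (Euclidean_space n) S). f y \<in> ball (f x) e}"
    by (rule openin_continuous_map_preimage[OF cm]) simp
  moreover have "topspace (subtopology (Euclidean_space n) S) = S"
    using openin_subset[OF assms(1)] by (rule topspace_subtopology_subset)
  ultimately have "openin (Euclidean_space n) {y \<in> S. f y \<in> ball (f x) e}"
    using openin_trans_full assms(1) by metis
  from openin_Euclidean_space_box[OF this, of x] assms that show thesis
    by (smt (verit) dist_real_def mem_Collect_eq mem_ball)
qed

text \<open>This treats one edge of the staircase path from \<open>z\<close> to \<open>y\<close>
  that changes one coordinate at a time. The mean value theorem on the \<open>j\<close>-th edge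
  produces \<open>partial j G\<close> at a nearby point, and continuity replaces it by the value at
  \<open>z\<close> with error at most \<open>e\<close>.\<close>

lemma partial_estimate:
  assumes T: "openin (Euclidean_space m) T" and z: "z \<in> T"
    and diff: "\<And>y j. y \<in> T \<Longrightarrow> j < m \<Longrightarrow> (\<lambda>t. G (y(j := t))) field_differentiable (at (y j))"
    and cont: "\<And>j. j < m \<Longrightarrow> continuous_on T (partial j G)"
    and j: "j < m" and e: "e > 0"
  obtains \<delta> where "\<delta> > 0"
    and "\<And>y. \<forall>i\<ge>m. y i = 0 \<Longrightarrow> \<forall>i<m. \<bar>y i - z i\<bar> < \<delta> \<Longrightarrow>
      \<bar>G (\<lambda>i. if i < Suc j then y i else z i) - G (\<lambda>i. if i < j then y i else z i)
        - partial j G z * (y j - z j)\<bar> \<le> e * \<bar>y j - z j\<bar>"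
proof -
  obtain d where d: "d > 0"
    "\<And>y. \<forall>i\<ge>m. y i = 0 \<Longrightarrow> \<forall>i<m. \<bar>y i - z i\<bar> < d \<Longrightarrow> y \<in> T \<and> \<bar>partial j G y - partial j G z\<bar> < e"
    using continuous_on_Euclidean_box[OF T z cont[OF j] e] by metis
  have "\<bar>G (\<lambda>i. if i < Suc j then y i else z i) - G (\<lambda>i. if i < j then y i else z i)
        - partial j G z * (y j - z j)\<bar> \<le> e * \<bar>y j - z j\<bar>"
    if y: "\<forall>i\<ge>m. y i = 0" "\<forall>i<m. \<bar>y i - z i\<bar> < d" for y
  proof -
    define w where "w s = (\<lambda>i. if i < j then y i else z i)(j := s)" for s
    have w1: "(\<lambda>i. if i < Suc j then y i else z i) = w (y j)"
      and w0: "(\<lambda>i. if i < j then y i else z i) = w (z j)"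
      by (auto simp: w_def fun_eq_iff less_Suc_eq)
    have box: "w s \<in> T \<and> \<bar>partial j G (w s) - partial j G z\<bar> < e" if "\<bar>s - z j\<bar> < d" for s
      using that y d(1) openin_Euclidean_space_tail[OF T z] j
      by (intro d(2)) (auto simp: w_def)
    have der: "((\<lambda>s. G (w s)) has_real_derivative partial j G (w s)) (at s)"
      if "\<bar>s - z j\<bar> < d" for s
    proof -
      have "(\<lambda>t. G ((w s)(j := t))) field_differentiable (at (w s j))"
        using diff box that j by blast
      then have "((\<lambda>t. G ((w s)(j := t))) has_field_derivative partial j G (w s)) (at (w s j))"
        unfolding partial_def by (simp add: field_differentiable_derivI)
      then show ?thesis by (simp add: w_def)
    qed
    have yz: "\<bar>y j - z j\<bar> < d" using y j by blast
    \<comment> \<open>\<open>MVT2\<close> requires a nondegenerate interval, hence the two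
      orientations. On a degenerate edge both sides vanish and \<open>z j\<close> itself serves as
      the intermediate point.\<close>
    consider "y j = z j" | "y j < z j" | "z j < y j" by linarith
    then have "\<exists>s. \<bar>s - z j\<bar> < d \<and> G (w (y j)) - G (w (z j)) = (y j - z j) * partial j G (w s)"
    proof cases
      case 2
      have "\<exists>s. y j < s \<and> s < z j \<and> G (w (z j)) - G (w (y j)) = (z j - y j) * partial j G (w s)"
        using yz 2 by (intro MVT2[where f = "\<lambda>s. G (w s)" and f' = "\<lambda>s. partial j G (w s)"] der) auto
      then show ?thesis using yz 2 by (smt (verit) mult_minus_left)
    next
      case 3
      have "\<exists>s. z j < s \<and> s < y j \<and> G (w (y j)) - G (w (z j)) = (y j - z j) * partial j G (w s)"
        using yz 3 by (intro MVT2[where f = "\<lambda>s. G (w s)" and f' = "\<lambda>s. partial j G (w s)"] der) auto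
      then show ?thesis using yz 3 by (smt (verit))
    next
      case 1
      then show ?thesis using d(1) by (intro exI[of _ "z j"]) simp
    qed
    then obtain s where s: "\<bar>s - z j\<bar> < d" "G (w (y j)) - G (w (z j)) = (y j - z j) * partial j G (w s)"
      by blast
    have "\<bar>G (w (y j)) - G (w (z j)) - partial j G z * (y j - z j)\<bar>
        = \<bar>partial j G (w s) - partial j G z\<bar> * \<bar>y j - z j\<bar>"
      unfolding s(2) abs_mult[symmetric] by (simp add: algebra_simps)
    also have "\<dots> \<le> e * \<bar>y j - z j\<bar>"
      using box[OF s(1)] by (intro mult_right_mono) auto
    finally show ?thesis unfolding w0 w1 .
  qed
  then show thesis using that d(1) by blast
qed

text \<open>The increment of \<open>G\<close> is telescoped along the staircase from
  \<open>\<gamma> t0\<close> to \<open>\<gamma> t\<close>. Each edge \<open>h j\<close> contributes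
  one summand of the chain rule, by \<open>partial_estimate\<close>.\<close>

lemma has_real_derivative_along_curve:
  assumes T: "openin (Euclidean_space m) T" and z: "\<gamma> t0 \<in> T"
    and diff: "\<And>y j. y \<in> T \<Longrightarrow> j < m \<Longrightarrow> (\<lambda>t. G (y(j := t))) field_differentiable (at (y j))"
    and cont: "\<And>j. j < m \<Longrightarrow> continuous_on T (partial j G)"
    and near: "eventually (\<lambda>t. \<gamma> t \<in> T) (nhds t0)"
    and der: "\<And>j. j < m \<Longrightarrow> ((\<lambda>t. \<gamma> t j) has_real_derivative d j) (at t0)"
  shows "((\<lambda>t. G (\<gamma> t)) has_real_derivative (\<Sum>j<m. partial j G (\<gamma> t0) * d j)) (at t0)"
proof -
  define z where "z = \<gamma> t0"
  define h where "h j t = G (\<lambda>i. if i < Suc j then \<gamma> t i else z i)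
    - G (\<lambda>i. if i < j then \<gamma> t i else z i)" for j t
  have tail: "\<forall>i\<ge>m. y i = 0" if "y \<in> T" for y
    using openin_Euclidean_space_tail[OF T that] by blast
  have "((h j) has_real_derivative partial j G z * d j) (at t0)" if j: "j < m" for j
  proof -
    \<comment> \<open>\<open>a\<close> is the slope of the \<open>j\<close>-th edge with respect to
      the coordinate \<open>\<gamma> t j\<close>. This coordinate may return to \<open>z j\<close>
      arbitrarily close to \<open>t0\<close>; giving the slope its limit as default value there
      makes the factorisation of \<open>h j\<close> valid for every \<open>t\<close>.\<close>
    define a where "a t = (if \<gamma> t j = z j then partial j G z else h j t / (\<gamma> t j - z j))" for t
    have h_eq: "h j t = a t * (\<gamma> t j - z j)" for t
    proof (cases "\<gamma> t j = z j")
      case True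
      then have "(\<lambda>i. if i < Suc j then \<gamma> t i else z i) = (\<lambda>i. if i < j then \<gamma> t i else z i)"
        by (auto simp: fun_eq_iff less_Suc_eq)
      then show ?thesis using True by (simp add: h_def)
    qed (simp add: a_def)
    have "(a \<longlongrightarrow> partial j G z) (at t0)"
    proof (rule tendstoI)
      fix e :: real assume "e > 0"
      then obtain \<delta> where \<delta>: "\<delta> > 0" "\<And>y. \<forall>i\<ge>m. y i = 0 \<Longrightarrow> \<forall>i<m. \<bar>y i - z i\<bar> < \<delta> \<Longrightarrow>
        \<bar>G (\<lambda>i. if i < Suc j then y i else z i) - G (\<lambda>i. if i < j then y i else z i)
        - partial j G z * (y j - z j)\<bar> \<le> (e/2) * \<bar>y j - z j\<bar>"
        using partial_estimate[OF T z diff cont j, of "e/2"] unfolding z_def by (smt (verit) half_gt_zero)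
      have "eventually (\<lambda>t. \<bar>\<gamma> t i - z i\<bar> < \<delta>) (at t0)" if "i < m" for i
      proof -
        have "((\<lambda>t. \<gamma> t i) \<longlongrightarrow> z i) (at t0)"
          using DERIV_isCont[OF der[OF that]] by (simp add: isCont_def z_def)
        from tendstoD[OF this \<delta>(1)] show ?thesis by (simp add: dist_real_def)
      qed
      then have "eventually (\<lambda>t. \<forall>i\<in>{..<m}. \<bar>\<gamma> t i - z i\<bar> < \<delta>) (at t0)"
        by (intro eventually_ball_finite) auto
      moreover have "eventually (\<lambda>t. \<gamma> t \<in> T) (at t0)"
        using near by (simp add: eventually_nhds_conv_at)
      ultimately show "eventually (\<lambda>t. dist (a t) (partial j G z) < e) (at t0)"
      proof eventually_elim
        case (elim t)
        show ?case
        proof (cases "\<gamma> t j = z j")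
          case False
          have "\<bar>a t * (\<gamma> t j - z j) - partial j G z * (\<gamma> t j - z j)\<bar> \<le> (e/2) * \<bar>\<gamma> t j - z j\<bar>"
            using \<delta>(2)[of "\<gamma> t"] elim tail unfolding h_eq[symmetric] h_def by auto
          then have "\<bar>a t - partial j G z\<bar> * \<bar>\<gamma> t j - z j\<bar> \<le> (e/2) * \<bar>\<gamma> t j - z j\<bar>"
            by (simp add: abs_mult[symmetric] left_diff_distrib)
          then show ?thesis using False \<open>e > 0\<close> by (simp add: dist_real_def)
        qed (simp add: a_def \<open>e > 0\<close>)
      qed
    qed
    moreover have "((\<lambda>t. (\<gamma> t j - z j) / (t - t0)) \<longlongrightarrow> d j) (at t0)"
      using der[OF j] by (simp add: has_field_derivative_iff z_def)
    ultimately have "((\<lambda>t. a t * ((\<gamma> t j - z j) / (t - t0))) \<longlongrightarrow> partial j G z * d j) (at t0)"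
      by (rule tendsto_mult)
    then show ?thesis
      unfolding has_field_derivative_iff by (simp add: h_eq z_def)
  qed
  then have "((\<lambda>t. G z + (\<Sum>j<m. h j t)) has_real_derivative 0 + (\<Sum>j<m. partial j G z * d j)) (at t0)"
    by (intro DERIV_add DERIV_const DERIV_sum) auto
  \<comment> \<open>Points of \<open>T\<close> vanish from coordinate \<open>m\<close> on, so
    \<open>m\<close> edges lead all the way from \<open>z\<close> to \<open>\<gamma> t\<close> and
    the sum telescopes.\<close>
  moreover have "eventually (\<lambda>t. G z + (\<Sum>j<m. h j t) = G (\<gamma> t)) (nhds t0)"
    using near
  proof eventually_elim
    case (elim t)
    have "(\<lambda>i. if i < m then \<gamma> t i else z i) = \<gamma> t"
      using tail[OF elim] tail[OF z] by (auto simp: z_def fun_eq_iff not_less)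
    then show ?case
      unfolding h_def using sum_lessThan_telescope[of "\<lambda>j. G (\<lambda>i. if i < j then \<gamma> t i else z i)" m] by simp
  qed
  ultimately show ?thesis
    using DERIV_cong_ev[of t0 t0 "\<lambda>t. G z + (\<Sum>j<m. h j t)" "\<lambda>t. G (\<gamma> t)"] by (simp add: z_def)
qed

text \<open>Sets open in \<open>Euclidean_space n\<close> are in general not open in the ambient
  space of sequences, to which \<open>continuous_on\<close> refers. Each neighbourhood
  \<open>T\<close> is therefore the trace of an ambient open set \<open>B\<close>; since
  \<open>S\<close> also lies in Euclidean space, \<open>B\<close> cuts exactly \<open>T\<close> out
  of \<open>S\<close>.\<close>

lemma continuous_on_Euclidean_local:
  fixes f :: "(nat \<Rightarrow> real) \<Rightarrow> 'd::topological_space"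
  assumes S: "openin (Euclidean_space n) S"
    and loc: "\<And>x. x \<in> S \<Longrightarrow> \<exists>T. openin (Euclidean_space n) T \<and> x \<in> T \<and> T \<subseteq> S \<and> continuous_on T f"
  shows "continuous_on S f"
  unfolding continuous_on_eq_continuous_within
proof
  fix x assume "x \<in> S"
  then obtain T where T: "openin (Euclidean_space n) T" "x \<in> T" "T \<subseteq> S" "continuous_on T f"
    using loc by blast
  then obtain B where B: "open B" "T = {x. \<forall>i\<ge>n. x i = 0} \<inter> B"
    by (auto simp: Euclidean_space_eq openin_open)
  have "S \<inter> B = T"
    using B T openin_Euclidean_space_tail[OF S] by auto
  then have "at x within S = at x within T"
    using B T(2) by (intro at_within_nhd[of x B]) auto
  then show "continuous (at x within S) f"
    using T by (simp add: continuous_on_eq_continuous_within)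
qed

subsection \<open>Stability properties of \<open>C\<^sup>k\<close> functions\<close>

lemma Ck_continuous_on: "openin (Euclidean_space n) S \<Longrightarrow> Ck n k f S \<Longrightarrow> continuous_on S f"
  by (cases k) (auto simp: continuous_map_Euclidean_real_iff)

lemma Ck_0_iff: "openin (Euclidean_space n) S \<Longrightarrow> Ck n 0 f S \<longleftrightarrow> continuous_on S f"
  by (simp add: continuous_map_Euclidean_real_iff)

lemma Ck_Suc_iff:
  "openin (Euclidean_space n) S \<Longrightarrow> Ck n (Suc k) f S \<longleftrightarrow> continuous_on S f \<and>
     (\<forall>i<n. (\<forall>x\<in>S. (\<lambda>t. f (x(i := t))) field_differentiable (at (x i))) \<and> Ck n k (partial i f) S)"
  by (simp add: continuous_map_Euclidean_real_iff)

declare Ck.simps [simp del]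

lemma partial_cong:
  assumes "openin (Euclidean_space n) S" and "x \<in> S" and "i < n" and "\<And>y. y \<in> S \<Longrightarrow> f y = g y"
  shows "partial i f x = partial i g x"
  unfolding partial_def
  using eventually_fun_upd_in_open[OF assms(1-3)]
  by (intro deriv_cong_ev refl) (auto elim!: eventually_mono simp: assms(4))

lemma line_field_differentiable_cong:
  assumes "openin (Euclidean_space n) S" and "x \<in> S" and "i < n" and "\<And>y. y \<in> S \<Longrightarrow> f y = g y"
    and "(\<lambda>t. f (x(i := t))) field_differentiable (at (x i))"
  shows "(\<lambda>t. g (x(i := t))) field_differentiable (at (x i))"
proof -
  have "eventually (\<lambda>t. f (x(i := t)) = g (x(i := t))) (nhds (x i))"
    using eventually_fun_upd_in_open[OF assms(1-3)]
    by (auto elim!: eventually_mono simp: assms(4))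
  then show ?thesis
    using assms(5) DERIV_cong_ev[OF refl _ refl] unfolding field_differentiable_def by metis
qed

lemma Ck_cong_imp:
  assumes "openin (Euclidean_space n) S"
  shows "(\<And>y. y \<in> S \<Longrightarrow> f y = g y) \<Longrightarrow> Ck n k f S \<Longrightarrow> Ck n k g S"
proof (induction k arbitrary: f g)
  case 0
  then show ?case using assms by (simp add: Ck_0_iff cong: continuous_on_cong)
next
  case (Suc k)
  have f: "continuous_on S f" "\<forall>i<n. (\<forall>x\<in>S. (\<lambda>t. f (x(i := t))) field_differentiable (at (x i)))
      \<and> Ck n k (partial i f) S"
    using Suc.prems(2) by (simp_all add: Ck_Suc_iff[OF assms])
  have "Ck n k (partial i g) S" if i: "i < n" for i
  proof (rule Suc.IH)
    show "partial i f y = partial i g y" if "y \<in> S" for y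
      using partial_cong[OF assms that i] Suc.prems(1) by blast
    show "Ck n k (partial i f) S" using f(2) i by blast
  qed
  moreover have "(\<lambda>t. g (x(i := t))) field_differentiable (at (x i))" if "i < n" "x \<in> S" for i x
  proof (rule line_field_differentiable_cong[OF assms that(2,1) Suc.prems(1)])
    show "(\<lambda>t. f (x(i := t))) field_differentiable (at (x i))" using f(2) that by simp
  qed
  moreover have "continuous_on S g"
  proof -
    have "continuous_on S f \<longleftrightarrow> continuous_on S g"
      by (rule continuous_on_cong) (simp_all add: Suc.prems(1))
    then show ?thesis using f(1) by simp
  qed
  ultimately show ?case using assms by (simp add: Ck_Suc_iff)
qed

lemma Ck_subset:
  assumes "openin (Euclidean_space n) S" and "openin (Euclidean_space n) T" and "T \<subseteq> S"
  shows "Ck n k f S \<Longrightarrow> Ck n k f T"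
proof (induction k arbitrary: f)
  case (Suc k)
  then show ?case using assms by (auto simp: Ck_Suc_iff intro: continuous_on_subset)
qed (use assms in \<open>auto simp: Ck_0_iff intro: continuous_on_subset\<close>)

lemma Ck_mono:
  assumes "openin (Euclidean_space n) S" and "k \<le> r" and "Ck n r f S"
  shows "Ck n k f S"
proof -
  have "Ck n (Suc j) f S \<Longrightarrow> Ck n j f S" for j f
    by (induction j arbitrary: f) (use assms(1) in \<open>auto simp: Ck_0_iff Ck_Suc_iff\<close>)
  with assms(2,3) show ?thesis by (induction rule: dec_induct) auto
qed

lemma Ck_line_differentiable:
  "openin (Euclidean_space n) S \<Longrightarrow> Ck n (Suc k) f S \<Longrightarrow> x \<in> S \<Longrightarrow> i < n \<Longrightarrow>
    (\<lambda>t. f (x(i := t))) field_differentiable (at (x i))"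
  by (simp add: Ck_Suc_iff)

lemma Ck_partial:
  "openin (Euclidean_space n) S \<Longrightarrow> Ck n (Suc k) f S \<Longrightarrow> i < n \<Longrightarrow> Ck n k (partial i f) S"
  by (simp add: Ck_Suc_iff)

text \<open>Locality is what allows composites of maps between manifolds to be treated although the
  chart on the middle manifold changes from point to point. The induction passes from
  \<open>f\<close> to \<open>partial i f\<close> on the same neighbourhoods.\<close>

lemma Ck_local:
  assumes S: "openin (Euclidean_space n) S"
    and loc: "\<And>x. x \<in> S \<Longrightarrow> \<exists>T. openin (Euclidean_space n) T \<and> x \<in> T \<and> T \<subseteq> S \<and> Ck n k f T"
  shows "Ck n k f S"
proof -
  have cont: "continuous_on S f" if *: "\<forall>x\<in>S. \<exists>T. openin (Euclidean_space n) T \<and> x \<in> T \<and> T \<subseteq> S \<and> Ck n k f T" for k f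
  proof (rule continuous_on_Euclidean_local[OF S])
    fix x assume "x \<in> S"
    then obtain T where "openin (Euclidean_space n) T" "x \<in> T" "T \<subseteq> S" "Ck n k f T"
      using * by blast
    then show "\<exists>T. openin (Euclidean_space n) T \<and> x \<in> T \<and> T \<subseteq> S \<and> continuous_on T f"
      using Ck_continuous_on by (intro exI[of _ T]) simp
  qed
  have "\<forall>x\<in>S. \<exists>T. openin (Euclidean_space n) T \<and> x \<in> T \<and> T \<subseteq> S \<and> Ck n k f T \<Longrightarrow> Ck n k f S"
  proof (induction k arbitrary: f)
    case 0
    from cont[OF this] show ?case by (simp add: Ck_0_iff[OF S])
  next
    case (Suc k)
    have "Ck n k (partial i f) S \<and> (\<forall>x\<in>S. (\<lambda>t. f (x(i := t))) field_differentiable (at (x i)))"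
      if i: "i < n" for i
    proof
      show "Ck n k (partial i f) S"
      proof (intro Suc.IH ballI)
        fix x assume "x \<in> S"
        then obtain T where "openin (Euclidean_space n) T" "x \<in> T" "T \<subseteq> S" "Ck n (Suc k) f T"
          using Suc.prems by blast
        then show "\<exists>T. openin (Euclidean_space n) T \<and> x \<in> T \<and> T \<subseteq> S \<and> Ck n k (partial i f) T"
          using i by (intro exI[of _ T]) (simp add: Ck_partial)
      qed
      show "\<forall>x\<in>S. (\<lambda>t. f (x(i := t))) field_differentiable (at (x i))"
      proof
        fix x assume "x \<in> S"
        then obtain T where "openin (Euclidean_space n) T" "x \<in> T" "Ck n (Suc k) f T"
          using Suc.prems by blast
        then show "(\<lambda>t. f (x(i := t))) field_differentiable (at (x i))"
          using i by (intro Ck_line_differentiable)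
      qed
    qed
    then show ?case using cont[OF Suc.prems] by (simp add: Ck_Suc_iff[OF S])
  qed
  then show ?thesis using loc by blast
qed

section \<open>Algebraic operations on C^k functions\<close>

lemma partial_const [simp]: "partial i (\<lambda>_. c) = (\<lambda>_. 0)"
  by (simp add: partial_def fun_eq_iff)

lemma Ck_const:
  assumes "openin (Euclidean_space n) S"
  shows "Ck n k (\<lambda>_. c) S"
  by (induction k arbitrary: c) (use assms in \<open>auto simp: Ck_0_iff Ck_Suc_iff\<close>)

lemma Ck_coordinate:
  assumes "openin (Euclidean_space n) S"
  shows "Ck n k (\<lambda>x. x j) S"
proof -
  have c: "continuous_on S (\<lambda>x :: nat \<Rightarrow> real. x j)"
    by (rule continuous_on_subset[OF continuous_on_product_coordinates subset_UNIV])
  have line: "(\<lambda>t. (x(i := t)) j) = (if i = j then (\<lambda>t. t) else (\<lambda>_. x j))" for i and x :: "nat \<Rightarrow> real"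
    by auto
  have p: "partial i (\<lambda>x. x j) = (\<lambda>_. if i = j then 1 else 0)" for i
    unfolding partial_def line by (simp add: fun_eq_iff)
  have d: "(\<lambda>t. (x(i := t)) j) field_differentiable (at (x i))" for i and x :: "nat \<Rightarrow> real"
    unfolding line by simp
  show ?thesis
    using c d p by (cases k) (simp_all only: Ck_0_iff[OF assms] Ck_Suc_iff[OF assms] Ck_const[OF assms] simp_thms Ball_def)
qed

lemma Ck_SucD: "openin (Euclidean_space n) S \<Longrightarrow> Ck n (Suc k) f S \<Longrightarrow> Ck n k f S"
  using Ck_mono[of n S k "Suc k" f] by simp

lemma partial_add:
  "openin (Euclidean_space n) S \<Longrightarrow> Ck n (Suc k) f S \<Longrightarrow> Ck n (Suc k) g S \<Longrightarrow> x \<in> S \<Longrightarrow> i < n \<Longrightarrow>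
    partial i (\<lambda>y. f y + g y) x = partial i f x + partial i g x"
  by (simp add: partial_def Ck_line_differentiable)

lemma partial_mult:
  "openin (Euclidean_space n) S \<Longrightarrow> Ck n (Suc k) f S \<Longrightarrow> Ck n (Suc k) g S \<Longrightarrow> x \<in> S \<Longrightarrow> i < n \<Longrightarrow>
    partial i (\<lambda>y. f y * g y) x = f x * partial i g x + partial i f x * g x"
  by (simp add: partial_def Ck_line_differentiable)

lemma Ck_SucI:
  assumes "openin (Euclidean_space n) S" and "continuous_on S f"
    and "\<And>i x. i < n \<Longrightarrow> x \<in> S \<Longrightarrow> (\<lambda>t. f (x(i := t))) field_differentiable (at (x i))"
    and "\<And>i. i < n \<Longrightarrow> Ck n k (partial i f) S"
  shows "Ck n (Suc k) f S"
  using assms(2-) by (simp add: Ck_Suc_iff[OF assms(1)])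

lemma Ck_add:
  assumes S: "openin (Euclidean_space n) S"
  shows "Ck n k f S \<Longrightarrow> Ck n k g S \<Longrightarrow> Ck n k (\<lambda>x. f x + g x) S"
proof (induction k arbitrary: f g)
  case 0
  then show ?case by (simp add: Ck_0_iff[OF S] continuous_on_add)
next
  case (Suc k)
  note f = Suc.prems(1) and g = Suc.prems(2)
  show ?case
  proof (rule Ck_SucI[OF S])
    show "continuous_on S (\<lambda>x. f x + g x)"
      by (intro continuous_on_add Ck_continuous_on[OF S f] Ck_continuous_on[OF S g])
    show "(\<lambda>t. f (x(i := t)) + g (x(i := t))) field_differentiable at (x i)" if "i < n" "x \<in> S" for i x
      by (intro Derivative.field_differentiable_add Ck_line_differentiable[OF S f that(2,1)] Ck_line_differentiable[OF S g that(2,1)])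
    show "Ck n k (partial i (\<lambda>x. f x + g x)) S" if i: "i < n" for i
      by (rule Ck_cong_imp[OF S _ Suc.IH[OF Ck_partial[OF S f i] Ck_partial[OF S g i]]])
        (rule partial_add[OF S f g _ i, symmetric])
  qed
qed

text \<open>The Leibniz rule leaves one factor undifferentiated in each summand.
  \<open>Ck_SucD\<close> lowers that factor by one order, so that the induction hypothesis applies
  to both products.\<close>

lemma Ck_mult:
  assumes S: "openin (Euclidean_space n) S"
  shows "Ck n k f S \<Longrightarrow> Ck n k g S \<Longrightarrow> Ck n k (\<lambda>x. f x * g x) S"
proof (induction k arbitrary: f g)
  case 0
  then show ?case by (simp add: Ck_0_iff[OF S] continuous_on_mult)
next
  case (Suc k)
  note f = Suc.prems(1) and g = Suc.prems(2)
  show ?case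
  proof (rule Ck_SucI[OF S])
    show "continuous_on S (\<lambda>x. f x * g x)"
      by (intro continuous_on_mult Ck_continuous_on[OF S f] Ck_continuous_on[OF S g])
    show "(\<lambda>t. f (x(i := t)) * g (x(i := t))) field_differentiable at (x i)" if "i < n" "x \<in> S" for i x
      by (intro field_differentiable_mult Ck_line_differentiable[OF S f that(2,1)] Ck_line_differentiable[OF S g that(2,1)])
    show "Ck n k (partial i (\<lambda>x. f x * g x)) S" if i: "i < n" for i
    proof (rule Ck_cong_imp[OF S])
      show "Ck n k (\<lambda>x. f x * partial i g x + partial i f x * g x) S"
        by (intro Ck_add[OF S] Suc.IH Ck_partial[OF S _ i] f g Ck_SucD[OF S f] Ck_SucD[OF S g])
    qed (rule partial_mult[OF S f g _ i, symmetric])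
  qed
qed

lemma Ck_sum:
  assumes "openin (Euclidean_space n) S" and "finite A" and "\<And>j. j \<in> A \<Longrightarrow> Ck n k (f j) S"
  shows "Ck n k (\<lambda>x. \<Sum>j\<in>A. f j x) S"
  using assms(2,3) by (induction A rule: finite_induct) (simp_all add: assms(1) Ck_const Ck_add)

section \<open>The chain rule for C^k functions of several variables\<close>

lemma has_real_derivative_compose_partials:
  assumes S: "openin (Euclidean_space n) S" and T: "openin (Euclidean_space m) T"
    and FS: "F ` S \<subseteq> T" and F: "\<And>j. j < m \<Longrightarrow> Ck n (Suc k) (\<lambda>y. F y j) S" and G: "Ck m (Suc k) G T"
    and x: "x \<in> S" and i: "i < n"
  shows "((\<lambda>t. G (F (x(i := t)))) has_real_derivative
    (\<Sum>j<m. partial j G (F x) * partial i (\<lambda>y. F y j) x)) (at (x i))"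
proof -
  have "((\<lambda>t. G (F (x(i := t)))) has_real_derivative
    (\<Sum>j<m. partial j G (F (x(i := x i))) * partial i (\<lambda>y. F y j) x)) (at (x i))"
  proof (rule has_real_derivative_along_curve[OF T])
    show "F (x(i := x i)) \<in> T" using FS x by auto
    show "\<forall>\<^sub>F t in nhds (x i). F (x(i := t)) \<in> T"
      using eventually_fun_upd_in_open[OF S x i] FS by (auto elim!: eventually_mono)
    show "(\<lambda>t. G (y(j := t))) field_differentiable at (y j)" if "y \<in> T" "j < m" for y j
      using Ck_line_differentiable[OF T G] that by blast
    show "continuous_on T (partial j G)" if "j < m" for j
      using Ck_partial[OF T G] Ck_continuous_on[OF T] that by blast
    show "((\<lambda>t. F (x(i := t)) j) has_real_derivative partial i (\<lambda>y. F y j) x) (at (x i))" if "j < m" for j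
      using Ck_line_differentiable[OF S F[OF that] x i] unfolding partial_def
      by (simp add: field_differentiable_derivI)
  qed
  then show ?thesis by simp
qed

lemma partial_compose:
  assumes "openin (Euclidean_space n) S" and "openin (Euclidean_space m) T"
    and "F ` S \<subseteq> T" and "\<And>j. j < m \<Longrightarrow> Ck n (Suc k) (\<lambda>y. F y j) S" and "Ck m (Suc k) G T"
    and "x \<in> S" and "i < n"
  shows "partial i (\<lambda>y. G (F y)) x = (\<Sum>j<m. partial j G (F x) * partial i (\<lambda>y. F y j) x)"
  using DERIV_imp_deriv[OF has_real_derivative_compose_partials[OF assms]] by (simp add: partial_def)

lemma continuous_on_into_Euclidean:
  assumes T: "openin (Euclidean_space m) T" and FS: "F ` S \<subseteq> T"
    and c: "\<And>j. j < m \<Longrightarrow> continuous_on S (\<lambda>y. F y j)"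
  shows "continuous_on S (F :: _ \<Rightarrow> nat \<Rightarrow> real)"
proof (rule continuous_on_coordinatewise_then_product)
  fix j
  show "continuous_on S (\<lambda>y. F y j)"
  proof (cases "j < m")
    case False
    then have "F y j = 0" if "y \<in> S" for y
      using openin_Euclidean_space_tail[OF T, of "F y" j] FS that by auto
    then show ?thesis by (simp cong: continuous_on_cong)
  qed (use c in auto)
qed

text \<open>The partial derivatives of the composite are sums of products of
  \<open>partial j G\<close>, composed with \<open>F\<close>, and partial derivatives of
  \<open>F\<close>. The first factors are again composites with the same \<open>F\<close>, one order
  lower, so only \<open>G\<close> varies in the induction.\<close>

lemma Ck_compose:
  assumes S: "openin (Euclidean_space n) S" and T: "openin (Euclidean_space m) T" and FS: "F ` S \<subseteq> T"
  shows "(\<And>j. j < m \<Longrightarrow> Ck n k (\<lambda>y. F y j) S) \<Longrightarrow> Ck m k G T \<Longrightarrow> Ck n k (\<lambda>y. G (F y)) S"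
proof (induction k arbitrary: G)
  have cont: "continuous_on S (\<lambda>y. G (F y))"
    if F: "\<And>j. j < m \<Longrightarrow> Ck n k (\<lambda>y. F y j) S" and G: "Ck m k G T" for k G
  proof (rule continuous_on_compose2[OF Ck_continuous_on[OF T G] _ FS])
    show "continuous_on S F"
      by (rule continuous_on_into_Euclidean[OF T FS Ck_continuous_on[OF S F]])
  qed
  {
    case 0
    show ?case using cont[OF "0.prems"] by (simp add: Ck_0_iff[OF S])
  next
    case (Suc k)
    note F = Suc.prems(1) and G = Suc.prems(2)
    show ?case
    proof (rule Ck_SucI[OF S cont[OF F G]])
      show "Ck n k (partial i (\<lambda>y. G (F y))) S" if i: "i < n" for i
      proof (rule Ck_cong_imp[OF S])
        show "Ck n k (\<lambda>x. \<Sum>j<m. partial j G (F x) * partial i (\<lambda>y. F y j) x) S"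
        proof (intro Ck_sum[OF S] Ck_mult[OF S])
          fix j assume "j \<in> {..<m}"
          then have j: "j < m" by simp
          show "Ck n k (\<lambda>x. partial j G (F x)) S"
            by (rule Suc.IH[OF Ck_SucD[OF S F] Ck_partial[OF T G j]])
          show "Ck n k (partial i (\<lambda>y. F y j)) S"
            by (rule Ck_partial[OF S F[OF j] i])
        qed simp
      qed (rule partial_compose[OF S T FS F G _ i, symmetric])
      show "(\<lambda>t. G (F (x(i := t)))) field_differentiable (at (x i))" if "i < n" "x \<in> S" for x i
        using has_real_derivative_compose_partials[OF S T FS F G that(2,1)] unfolding field_differentiable_def by blast
    qed
  }
qed

subsection \<open>Equality of jets\<close>

text \<open>Equality of jets for scalar functions, with the same recursion as \<open>Ck\<close>, so
  that the Leibniz and chain rules for jets follow by inductions of the same shape.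
  \<open>jet_eq_iff_jet\<close> connects it with \<open>jet\<close>.\<close>

primrec jet_eq :: "nat \<Rightarrow> nat \<Rightarrow> ((nat \<Rightarrow> real) \<Rightarrow> real) \<Rightarrow> ((nat \<Rightarrow> real) \<Rightarrow> real) \<Rightarrow> (nat \<Rightarrow> real) \<Rightarrow> bool" where
  "jet_eq n 0 f g x \<longleftrightarrow> f x = g x"
| "jet_eq n (Suc k) f g x \<longleftrightarrow> f x = g x \<and> (\<forall>i<n. jet_eq n k (partial i f) (partial i g) x)"

lemma jet_eq_value: "jet_eq n k f g x \<Longrightarrow> f x = g x"
  by (cases k) auto

lemma jet_eq_refl: "jet_eq n k f f x"
  by (induction k arbitrary: f) auto

lemma jet_eq_SucD: "jet_eq n (Suc k) f g x \<Longrightarrow> jet_eq n k f g x"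
  by (induction k arbitrary: f g) auto

lemma jet_eq_trans: "jet_eq n k f g x \<Longrightarrow> jet_eq n k g h x \<Longrightarrow> jet_eq n k f h x"
  by (induction k arbitrary: f g h) auto

lemma jet_eq_local:
  assumes S: "openin (Euclidean_space n) S" and x: "x \<in> S"
  shows "(\<And>y. y \<in> S \<Longrightarrow> f y = g y) \<Longrightarrow> jet_eq n k f g x"
proof (induction k arbitrary: f g)
  case 0
  then show ?case using x by simp
next
  case (Suc k)
  have "jet_eq n k (partial i f) (partial i g) x" if "i < n" for i
    by (rule Suc.IH, rule partial_cong[OF S _ that Suc.prems])
  then show ?case using Suc.prems[OF x] by simp
qed

lemma jet_eq_cong:
  assumes "openin (Euclidean_space n) S" and "x \<in> S"
    and "\<And>y. y \<in> S \<Longrightarrow> f y = f' y" and "\<And>y. y \<in> S \<Longrightarrow> g y = g' y" and "jet_eq n k f' g' x"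
  shows "jet_eq n k f g x"
proof -
  have "jet_eq n k f f' x" "jet_eq n k g' g x"
    by (rule jet_eq_local[OF assms(1,2)], simp add: assms(3,4))+
  then show ?thesis using assms(5) jet_eq_trans by blast
qed

text \<open>The recursion of \<open>jet_eq\<close> peels off the derivative that is taken first. In
  \<open>partials\<close> this is the last index of the list, because \<open>foldr\<close> works
  from the right; hence lists are split at their end.\<close>

lemma jet_eq_iff_partials:
  "jet_eq n k f g x \<longleftrightarrow>
    (\<forall>is. length is \<le> k \<and> set is \<subseteq> {..<n} \<longrightarrow> partials is f x = partials is g x)"
proof (induction k arbitrary: f g)
  case 0
  then show ?case by (simp add: partials_def)
next
  case (Suc k)
  have snoc: "partials (is @ [i]) f = partials is (partial i f)" for "is" i f
    by (simp add: partials_def)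
  have "(\<forall>is. length is \<le> Suc k \<and> set is \<subseteq> {..<n} \<longrightarrow> partials is f x = partials is g x) \<longleftrightarrow>
    f x = g x \<and> (\<forall>i<n. \<forall>is. length is \<le> k \<and> set is \<subseteq> {..<n} \<longrightarrow>
      partials (is @ [i]) f x = partials (is @ [i]) g x)" (is "?L \<longleftrightarrow> ?R")
  proof
    assume L: ?L
    have "partials [] f x = partials [] g x" using L[rule_format, of "[]"] by simp
    then show ?R using L by (auto simp: partials_def[of "[]"])
  next
    assume R: ?R
    show ?L
    proof (intro allI impI)
      fix js assume js: "length js \<le> Suc k \<and> set js \<subseteq> {..<n}"
      show "partials js f x = partials js g x"
        using R js by (cases js rule: rev_cases) (auto simp: partials_def[of "[]"])
    qed
  qed
  then show ?case by (simp add: Suc.IH snoc)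
qed

lemma jet_eq_iff_jet:
  "jet n k F x = jet n k F' x \<longleftrightarrow> (\<forall>a<n. jet_eq n k (\<lambda>y. F y a) (\<lambda>y. F' y a) x)"
  unfolding jet_eq_iff_partials jet_def fun_eq_iff by (auto split: if_splits)

lemma jet_eq_add:
  assumes S: "openin (Euclidean_space n) S" and x: "x \<in> S"
  shows "Ck n k f S \<Longrightarrow> Ck n k f' S \<Longrightarrow> Ck n k g S \<Longrightarrow> Ck n k g' S \<Longrightarrow>
    jet_eq n k f f' x \<Longrightarrow> jet_eq n k g g' x \<Longrightarrow> jet_eq n k (\<lambda>y. f y + g y) (\<lambda>y. f' y + g' y) x"
proof (induction k arbitrary: f f' g g')
  case (Suc k)
  note f = Suc.prems(1) and f' = Suc.prems(2) and g = Suc.prems(3) and g' = Suc.prems(4)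
  have "jet_eq n k (partial i (\<lambda>y. f y + g y)) (partial i (\<lambda>y. f' y + g' y)) x" if i: "i < n" for i
  proof (rule jet_eq_cong[OF S x partial_add[OF S f g _ i] partial_add[OF S f' g' _ i]])
    show "jet_eq n k (\<lambda>y. partial i f y + partial i g y) (\<lambda>y. partial i f' y + partial i g' y) x"
      using Suc.prems(5,6) i by (intro Suc.IH Ck_partial[OF S _ i] f f' g g') simp_all
  qed
  then show ?case using Suc.prems(5,6) by simp
qed simp

lemma jet_eq_mult:
  assumes S: "openin (Euclidean_space n) S" and x: "x \<in> S"
  shows "Ck n k f S \<Longrightarrow> Ck n k f' S \<Longrightarrow> Ck n k g S \<Longrightarrow> Ck n k g' S \<Longrightarrow>
    jet_eq n k f f' x \<Longrightarrow> jet_eq n k g g' x \<Longrightarrow> jet_eq n k (\<lambda>y. f y * g y) (\<lambda>y. f' y * g' y) x"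
proof (induction k arbitrary: f f' g g')
  case (Suc k)
  note f = Suc.prems(1) and f' = Suc.prems(2) and g = Suc.prems(3) and g' = Suc.prems(4)
  note lower = Ck_SucD[OF S f] Ck_SucD[OF S f'] Ck_SucD[OF S g] Ck_SucD[OF S g']
  have "jet_eq n k (partial i (\<lambda>y. f y * g y)) (partial i (\<lambda>y. f' y * g' y)) x" if i: "i < n" for i
  proof (rule jet_eq_cong[OF S x partial_mult[OF S f g _ i] partial_mult[OF S f' g' _ i]])
    note partials = Ck_partial[OF S f i] Ck_partial[OF S f' i] Ck_partial[OF S g i] Ck_partial[OF S g' i]
    have "jet_eq n k (partial i f) (partial i f') x" "jet_eq n k (partial i g) (partial i g') x"
      using Suc.prems(5,6) i by simp_all
    then show "jet_eq n k (\<lambda>y. f y * partial i g y + partial i f y * g y)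
        (\<lambda>y. f' y * partial i g' y + partial i f' y * g' y) x"
      by (intro jet_eq_add[OF S x] Suc.IH Ck_mult[OF S] lower partials
          jet_eq_SucD[OF Suc.prems(5)] jet_eq_SucD[OF Suc.prems(6)])
  qed
  then show ?case using Suc.prems(5,6) by simp
qed simp

lemma jet_eq_sum:
  assumes S: "openin (Euclidean_space n) S" and x: "x \<in> S" and "finite A"
    and "\<And>j. j \<in> A \<Longrightarrow> Ck n k (f j) S" and "\<And>j. j \<in> A \<Longrightarrow> Ck n k (f' j) S"
    and "\<And>j. j \<in> A \<Longrightarrow> jet_eq n k (f j) (f' j) x"
  shows "jet_eq n k (\<lambda>y. \<Sum>j\<in>A. f j y) (\<lambda>y. \<Sum>j\<in>A. f' j y) x"
  using assms(3-)
  by (induction A rule: finite_induct) (simp_all add: jet_eq_refl jet_eq_add[OF S x] Ck_sum[OF S])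

text \<open>This is the reason why composition of jets is well defined. By the chain rule, a partial
  derivative of the composite is built from \<open>partial j G\<close> composed with
  \<open>F\<close>, whose jet is determined by the induction hypothesis, and from the partial
  derivatives of \<open>F\<close>; \<open>jet_eq_mult\<close> and \<open>jet_eq_sum\<close> assemble
  the pieces.\<close>

lemma jet_eq_compose:
  assumes S: "openin (Euclidean_space n) S" and T: "openin (Euclidean_space m) T"
    and FS: "F ` S \<subseteq> T" "F' ` S \<subseteq> T" and x: "x \<in> S"
  shows "(\<And>j. j < m \<Longrightarrow> Ck n k (\<lambda>y. F y j) S) \<Longrightarrow> (\<And>j. j < m \<Longrightarrow> Ck n k (\<lambda>y. F' y j) S) \<Longrightarrow>
    Ck m k G T \<Longrightarrow> (\<And>j. j < m \<Longrightarrow> jet_eq n k (\<lambda>y. F y j) (\<lambda>y. F' y j) x) \<Longrightarrow>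
    jet_eq n k (\<lambda>y. G (F y)) (\<lambda>y. G (F' y)) x"
proof (induction k arbitrary: G)
  \<comment> \<open>Only the first \<open>m\<close> components are compared. The remaining ones
    vanish, since both values lie in \<open>T\<close>.\<close>
  have eq: "F x = F' x" if "\<And>j. j < m \<Longrightarrow> F x j = F' x j"
  proof
    fix j
    have "F x \<in> T" "F' x \<in> T" using FS x by auto
    then show "F x j = F' x j"
      using that openin_Euclidean_space_tail[OF T, of _ j] by (metis not_less)
  qed
  {
    case 0
    then show ?case using eq by simp
  next
    case (Suc k)
    note F = Suc.prems(1) and F' = Suc.prems(2) and G = Suc.prems(3) and J = Suc.prems(4)
    have "F x = F' x" by (rule eq) (rule jet_eq_value[OF J])
    moreover have "jet_eq n k (partial i (\<lambda>y. G (F y))) (partial i (\<lambda>y. G (F' y))) x" if i: "i < n" for i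
    proof (rule jet_eq_cong[OF S x partial_compose[OF S T FS(1) F G _ i] partial_compose[OF S T FS(2) F' G _ i]])
      note lower = Ck_SucD[OF S F] Ck_SucD[OF S F']
      show "jet_eq n k (\<lambda>y. \<Sum>j<m. partial j G (F y) * partial i (\<lambda>y. F y j) y)
          (\<lambda>y. \<Sum>j<m. partial j G (F' y) * partial i (\<lambda>y. F' y j) y) x"
      proof (rule jet_eq_sum[OF S x])
        fix j assume "j \<in> {..<m}"
        then have j: "j < m" by simp
        note dG = Ck_partial[OF T G j] and dF = Ck_partial[OF S F[OF j] i] Ck_partial[OF S F'[OF j] i]
        have comp: "Ck n k (\<lambda>y. partial j G (F y)) S" "Ck n k (\<lambda>y. partial j G (F' y)) S"
          by (rule Ck_compose[OF S T FS(1) _ dG], rule lower, assumption)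
            (rule Ck_compose[OF S T FS(2) _ dG], rule lower, assumption)
        show "Ck n k (\<lambda>y. partial j G (F y) * partial i (\<lambda>y. F y j) y) S"
          "Ck n k (\<lambda>y. partial j G (F' y) * partial i (\<lambda>y. F' y j) y) S"
          by (rule Ck_mult[OF S comp(1) dF(1)], rule Ck_mult[OF S comp(2) dF(2)])
        have "jet_eq n k (\<lambda>y. partial j G (F y)) (\<lambda>y. partial j G (F' y)) x"
          by (rule Suc.IH[OF _ _ dG jet_eq_SucD[OF J]]) (rule lower, assumption)+
        moreover have "jet_eq n k (partial i (\<lambda>y. F y j)) (partial i (\<lambda>y. F' y j)) x"
          using J[OF j] i by simp
        ultimately show "jet_eq n k (\<lambda>y. partial j G (F y) * partial i (\<lambda>y. F y j) y)
          (\<lambda>y. partial j G (F' y) * partial i (\<lambda>y. F' y j) y) x"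
          by (rule jet_eq_mult[OF S x comp dF])
      qed simp
    qed
    ultimately show ?case by simp
  }
qed

section \<open>Jets as functions of the base point\<close>

lemma continuous_on_partials:
  assumes S: "openin (Euclidean_space n) S"
  shows "Ck n k f S \<Longrightarrow> length is \<le> k \<Longrightarrow> set is \<subseteq> {..<n} \<Longrightarrow> continuous_on S (partials is f)"
proof (induction "is" arbitrary: k f rule: rev_induct)
  case Nil
  have "partials [] f = f" by (simp add: partials_def fun_eq_iff)
  then show ?case using Ck_continuous_on[OF S Nil(1)] by simp
next
  case (snoc i js)
  then obtain l where l: "k = Suc l" by (cases k) auto
  have "partials (js @ [i]) f = partials js (partial i f)" by (simp add: partials_def)
  moreover have "continuous_on S (partials js (partial i f))"
    using snoc.prems l by (intro snoc.IH[of l] Ck_partial[OF S]) auto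
  ultimately show ?case by simp
qed

text \<open>The product topology on jets reduces the claim to single entries, which are iterated
  partial derivatives of order at most \<open>k\<close> or constantly \<open>0\<close>.\<close>

lemma continuous_on_jet:
  assumes "openin (Euclidean_space n) S" and "\<And>a. a < n \<Longrightarrow> Ck n k (\<lambda>y. F y a) S"
  shows "continuous_on S (jet n k F)"
proof (intro continuous_on_coordinatewise_then_product)
  fix js a
  show "continuous_on S (\<lambda>x. jet n k F x js a)"
  proof (cases "length js \<le> k \<and> set js \<subseteq> {..<n} \<and> a < n")
    case True
    then have "continuous_on S (partials js (\<lambda>y. F y a))"
      by (intro continuous_on_partials[OF assms(1) assms(2)]) simp_all
    then show ?thesis using True by (simp add: jet_def)
  next
    case False
    then have zero: "jet n k F x js a = 0" for x unfolding jet_def by meson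
    show ?thesis unfolding zero by (rule continuous_on_const)
  qed
qed

text \<open>\<open>deriv\<close> is chosen from the relation of having a given derivative, and that
  relation is itself invariant under shifts. The identity therefore holds for every function
  \<open>f\<close>, also at points where \<open>deriv\<close> is an arbitrary value.\<close>

lemma partial_translate:
  "partial i (\<lambda>y. f (\<lambda>j. y j + t j)) x = partial i f (\<lambda>j. x j + t j)"
proof -
  have "(\<lambda>j. (x(i := s)) j + t j) = (\<lambda>j. x j + t j)(i := s + t i)" for s
    by auto
  then show ?thesis
    by (simp add: partial_def deriv_def DERIV_shift)
qed

lemma partials_translate:
  "partials is (\<lambda>y. f (\<lambda>j. y j + t j)) = (\<lambda>x. partials is f (\<lambda>j. x j + t j))"
proof (induction "is")
  case (Cons i js)
  have "partials (i # js) (\<lambda>y. f (\<lambda>j. y j + t j)) = partial i (\<lambda>x. partials js f (\<lambda>j. x j + t j))"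
    using Cons.IH by (simp add: partials_def)
  also have "\<dots> = (\<lambda>x. partials (i # js) f (\<lambda>j. x j + t j))"
    by (rule ext) (simp add: partial_translate partials_def)
  finally show ?case .
qed (simp add: partials_def)

text \<open>At \<open>x = origin\<close> this turns the jet of a translated parametrisation into the
  jet of the original one at \<open>t\<close>. Continuity of the moving frame thus becomes
  continuity of jets in the base point.\<close>

lemma jet_translate:
  "jet n k (\<lambda>y. F (\<lambda>j. y j + t j)) x = jet n k F (\<lambda>j. x j + t j)"
proof -
  have "partials js (\<lambda>y. F (\<lambda>j. y j + t j) a) x = partials js (\<lambda>y. F y a) (\<lambda>j. x j + t j)" for js a
    using partials_translate[of js "\<lambda>y. F y a" t] by simp
  then show ?thesis by (simp only: jet_def)
qed

subsection \<open>\<open>C\<^sup>k\<close> maps between manifolds\<close>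

lemma openin_continuous_preimage:
  assumes "openin X S" and "continuous_map (subtopology X S) Y f" and "openin Y V"
  shows "openin X {x \<in> S. f x \<in> V}"
proof -
  have "openin (subtopology X S) {x \<in> topspace (subtopology X S). f x \<in> V}"
    using assms(2,3) by (rule openin_continuous_map_preimage)
  moreover have "topspace (subtopology X S) = S"
    using openin_subset[OF assms(1)] by (rule topspace_subtopology_subset)
  ultimately show ?thesis using openin_trans_full assms(1) by metis
qed

lemma chart_properties:
  assumes "smooth_manifold M" and "(U, c) \<in> charts M"
  shows "openin (mtop M) U" and "openin (Euclidean_space (mdim M)) (c ` U)" and "inj_on c U"
    and "continuous_map (subtopology (mtop M) U) (Euclidean_space (mdim M)) c"
    and "continuous_map (subtopology (Euclidean_space (mdim M)) (c ` U)) (mtop M) (inv_into U c)"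
    and "\<And>B. openin (mtop M) B \<Longrightarrow> B \<subseteq> U \<Longrightarrow> openin (Euclidean_space (mdim M)) (c ` B)"
proof -
  let ?E = "Euclidean_space (mdim M)"
  show U: "openin (mtop M) U" and cU: "openin ?E (c ` U)"
    using assms unfolding smooth_manifold_def by auto
  have h: "homeomorphic_map (subtopology (mtop M) U) (subtopology ?E (c ` U)) c"
    using assms unfolding smooth_manifold_def by auto
  have tU: "topspace (subtopology (mtop M) U) = U" and tc: "topspace (subtopology ?E (c ` U)) = c ` U"
    using openin_subset[OF U] openin_subset[OF cU] by (blast intro!: topspace_subtopology_subset)+
  show inj: "inj_on c U"
    using h tU by (simp add: homeomorphic_eq_everything_map)
  show "continuous_map (subtopology (mtop M) U) ?E c"
    using homeomorphic_imp_continuous_map[OF h] continuous_map_in_subtopology by blast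
  show op: "openin ?E (c ` B)" if "openin (mtop M) B" "B \<subseteq> U" for B
  proof -
    have "openin (subtopology (mtop M) U) B"
      using that U by (simp add: openin_open_subtopology)
    then have "openin (subtopology ?E (c ` U)) (c ` B)"
      using homeomorphic_imp_open_map[OF h] by (simp add: open_map_def)
    then show ?thesis using openin_trans_full cU by blast
  qed
  show "continuous_map (subtopology ?E (c ` U)) (mtop M) (inv_into U c)"
    unfolding continuous_map_alt
  proof (intro conjI allI impI)
    fix V assume "openin (mtop M) V"
    then have "openin ?E (c ` (U \<inter> V))" using U by (intro op) auto
    moreover have "inv_into U c -` V \<inter> topspace (subtopology ?E (c ` U)) = c ` (U \<inter> V)"
      unfolding tc using inj by auto
    ultimately show "openin (subtopology ?E (c ` U)) (inv_into U c -` V \<inter> topspace (subtopology ?E (c ` U)))"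
      using cU by (simp add: openin_open_subtopology image_mono)
  next
    show "inv_into U c \<in> topspace (subtopology ?E (c ` U)) \<rightarrow> mpoints M"
      unfolding tc using openin_subset[OF U] inj by auto
  qed
qed

lemma chart_at:
  assumes "smooth_manifold M" and "x \<in> mpoints M"
  obtains U c where "(U, c) \<in> charts M" and "x \<in> U"
  using assms unfolding smooth_manifold_def by blast

lemma chart_transition_Ck:
  assumes "smooth_manifold M" and "(U, c) \<in> charts M" and "(U', c') \<in> charts M" and "a < mdim M"
  shows "Ck (mdim M) k (\<lambda>y. c' (inv_into U c y) a) (c ` (U \<inter> U'))"
  using assms unfolding smooth_manifold_def by fast

lemma Ck_map_openin: "Ck_map k M S N f \<Longrightarrow> openin (mtop M) S"
  by (simp add: Ck_map_def)

lemma Ck_map_continuous: "Ck_map k M S N f \<Longrightarrow> continuous_map (subtopology (mtop M) S) (mtop N) f"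
  by (simp add: Ck_map_def)

lemma Ck_map_charts:
  "Ck_map k M S N f \<Longrightarrow> (U, c) \<in> charts M \<Longrightarrow> (U', c') \<in> charts N \<Longrightarrow> a < mdim N \<Longrightarrow>
    Ck (mdim M) k (\<lambda>y. c' (f (inv_into U c y)) a) (c ` {x \<in> U \<inter> S. f x \<in> U'})"
  unfolding Ck_map_def by fast

lemma Ck_mapI:
  assumes "openin (mtop M) S" and "continuous_map (subtopology (mtop M) S) (mtop N) f"
    and "\<And>U c U' c' a. (U, c) \<in> charts M \<Longrightarrow> (U', c') \<in> charts N \<Longrightarrow> a < mdim N \<Longrightarrow>
      Ck (mdim M) k (\<lambda>y. c' (f (inv_into U c y)) a) (c ` {x \<in> U \<inter> S. f x \<in> U'})"
  shows "Ck_map k M S N f"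
  using assms unfolding Ck_map_def by fast

lemma Ck_map_preimage_openin:
  "Ck_map k M S N f \<Longrightarrow> openin (mtop N) V \<Longrightarrow> openin (mtop M) {x \<in> S. f x \<in> V}"
  using openin_continuous_preimage Ck_map_openin Ck_map_continuous by metis

lemma Ck_map_into:
  assumes "Ck_map k M S N f" and "x \<in> S" shows "f x \<in> mpoints N"
proof -
  have "topspace (subtopology (mtop M) S) = S"
    using openin_subset[OF Ck_map_openin[OF assms(1)]] by (rule topspace_subtopology_subset)
  then show ?thesis
    using continuous_map_image_subset_topspace[OF Ck_map_continuous[OF assms(1)]] assms(2) by auto
qed

text \<open>\<open>Ck\<close> is meaningful on open sets only; this guarantees it for the coordinate
  domains on which \<open>Ck_map\<close> tests a map.\<close>

lemma Ck_map_chart_domain_openin: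
  assumes "smooth_manifold M" and "smooth_manifold N" and "Ck_map k M S N f"
    and "(U, c) \<in> charts M" and "(U', c') \<in> charts N"
  shows "openin (Euclidean_space (mdim M)) (c ` {x \<in> U \<inter> S. f x \<in> U'})"
proof (rule chart_properties(6)[OF assms(1,4)])
  have "openin (mtop M) (U \<inter> {x \<in> S. f x \<in> U'})"
    using chart_properties(1)[OF assms(1,4)] Ck_map_preimage_openin[OF assms(3) chart_properties(1)[OF assms(2,5)]]
    by (rule openin_Int)
  moreover have "U \<inter> {x \<in> S. f x \<in> U'} = {x \<in> U \<inter> S. f x \<in> U'}" by blast
  ultimately show "openin (mtop M) {x \<in> U \<inter> S. f x \<in> U'}" by simp
qed blast

lemma Ck_map_mono:
  assumes "smooth_manifold M" and "smooth_manifold N" and "k \<le> r" and "Ck_map r M S N f"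
  shows "Ck_map k M S N f"
proof (rule Ck_mapI[OF Ck_map_openin[OF assms(4)] Ck_map_continuous[OF assms(4)]])
  fix U c U' c' a
  assume c: "(U, c) \<in> charts M" "(U', c') \<in> charts N" "a < mdim N"
  show "Ck (mdim M) k (\<lambda>y. c' (f (inv_into U c y)) a) (c ` {x \<in> U \<inter> S. f x \<in> U'})"
    by (rule Ck_mono[OF Ck_map_chart_domain_openin[OF assms(1,2,4) c(1,2)] assms(3) Ck_map_charts[OF assms(4) c]])
qed

lemma Ck_map_cong:
  assumes "smooth_manifold M" and "smooth_manifold N" and f: "Ck_map k M S N f"
    and eq: "\<And>x. x \<in> S \<Longrightarrow> f x = g x"
  shows "Ck_map k M S N g"
proof (rule Ck_mapI[OF Ck_map_openin[OF f]])
  have "topspace (subtopology (mtop M) S) \<subseteq> S" by simp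
  then show "continuous_map (subtopology (mtop M) S) (mtop N) g"
    using eq by (intro continuous_map_eq[OF Ck_map_continuous[OF f]]) blast
  fix U c U' c' a
  assume c: "(U, c) \<in> charts M" "(U', c') \<in> charts N" "a < mdim N"
  have dom: "{x \<in> U \<inter> S. f x \<in> U'} = {x \<in> U \<inter> S. g x \<in> U'}" using eq by auto
  show "Ck (mdim M) k (\<lambda>y. c' (g (inv_into U c y)) a) (c ` {x \<in> U \<inter> S. g x \<in> U'})"
    unfolding dom[symmetric]
  proof (rule Ck_cong_imp[OF Ck_map_chart_domain_openin[OF assms(1,2) f c(1,2)] _ Ck_map_charts[OF f c]])
    fix y assume "y \<in> c ` {x \<in> U \<inter> S. f x \<in> U'}"
    then have "inv_into U c y \<in> S" using chart_properties(3)[OF assms(1) c(1)] by auto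
    then show "c' (f (inv_into U c y)) a = c' (g (inv_into U c y)) a" by (simp add: eq)
  qed
qed

lemma Ck_map_subset:
  assumes "smooth_manifold M" and "smooth_manifold N" and f: "Ck_map k M S N f"
    and T: "openin (mtop M) T" "T \<subseteq> S"
  shows "Ck_map k M T N f"
proof (rule Ck_mapI[OF T(1)])
  show cont: "continuous_map (subtopology (mtop M) T) (mtop N) f"
    using continuous_map_from_subtopology_mono[OF Ck_map_continuous[OF f] T(2)] .
  fix U c U' c' a
  assume c: "(U, c) \<in> charts M" "(U', c') \<in> charts N" "a < mdim N"
  have "openin (mtop M) (U \<inter> {x \<in> T. f x \<in> U'})"
    using chart_properties(1)[OF assms(1) c(1)]
      openin_continuous_preimage[OF T(1) cont chart_properties(1)[OF assms(2) c(2)]]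
    by (rule openin_Int)
  moreover have "U \<inter> {x \<in> T. f x \<in> U'} = {x \<in> U \<inter> T. f x \<in> U'}" by blast
  ultimately have op: "openin (Euclidean_space (mdim M)) (c ` {x \<in> U \<inter> T. f x \<in> U'})"
    by (intro chart_properties(6)[OF assms(1) c(1)]) auto
  show "Ck (mdim M) k (\<lambda>y. c' (f (inv_into U c y)) a) (c ` {x \<in> U \<inter> T. f x \<in> U'})"
    using T(2) by (intro Ck_subset[OF Ck_map_chart_domain_openin[OF assms(1,2) f c(1,2)] op _ Ck_map_charts[OF f c]]) auto
qed

text \<open>Near a point \<open>x\<close> a chart of \<open>N\<close> around \<open>f x\<close> is
  inserted. There the coordinate expression of the composite is the composite \<open>G (F y)\<close>
  of two coordinate expressions of class C^k, and \<open>Ck_local\<close> glues the local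
  statements.\<close>

lemma Ck_map_compose:
  assumes M: "smooth_manifold M" and N: "smooth_manifold N" and P: "smooth_manifold P"
    and f: "Ck_map k M S N f" and g: "Ck_map k N T P g" and fS: "f ` S \<subseteq> T"
  shows "Ck_map k M S P (\<lambda>x. g (f x))"
proof (rule Ck_mapI[OF Ck_map_openin[OF f]])
  have "continuous_map (subtopology (mtop M) S) (subtopology (mtop N) T) f"
    using Ck_map_continuous[OF f] fS by (auto simp: continuous_map_in_subtopology)
  from continuous_map_compose[OF this Ck_map_continuous[OF g]]
  show "continuous_map (subtopology (mtop M) S) (mtop P) (\<lambda>x. g (f x))"
    by (simp add: o_def)
  fix U c W e a
  assume c: "(U, c) \<in> charts M" and e: "(W, e) \<in> charts P" and a: "a < mdim P"
  define Q where "Q = {x \<in> U \<inter> S. g (f x) \<in> W}"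
  have gW: "openin (mtop N) {z \<in> T. g z \<in> W}"
    by (rule Ck_map_preimage_openin[OF g chart_properties(1)[OF P e]])
  have "Q = U \<inter> {x \<in> S. f x \<in> {z \<in> T. g z \<in> W}}" using fS by (auto simp: Q_def)
  then have Q: "openin (mtop M) Q"
    using openin_Int[OF chart_properties(1)[OF M c] Ck_map_preimage_openin[OF f gW]] by simp
  note inj = chart_properties(3)[OF M c]
  show "Ck (mdim M) k (\<lambda>y. e (g (f (inv_into U c y))) a) (c ` {x \<in> U \<inter> S. g (f x) \<in> W})"
    unfolding Q_def[symmetric]
  proof (rule Ck_local)
    show "openin (Euclidean_space (mdim M)) (c ` Q)"
      by (rule chart_properties(6)[OF M c Q]) (auto simp: Q_def)
    fix y assume "y \<in> c ` Q"
    then obtain x where x: "x \<in> Q" "y = c x" by blast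
    then obtain U' c' where c': "(U', c') \<in> charts N" "f x \<in> U'"
      using chart_at[OF N Ck_map_into[OF f]] by (metis (mono_tags, lifting) IntD2 Q_def mem_Collect_eq)
    define Q' where "Q' = {x \<in> Q. f x \<in> U'}"
    have "Q' = Q \<inter> {x \<in> S. f x \<in> U'}" by (auto simp: Q'_def Q_def)
    then have "openin (mtop M) Q'"
      using openin_Int[OF Q Ck_map_preimage_openin[OF f chart_properties(1)[OF N c'(1)]]] by simp
    then have cQ': "openin (Euclidean_space (mdim M)) (c ` Q')"
      by (intro chart_properties(6)[OF M c]) (auto simp: Q'_def Q_def)
    define F where "F y = c' (f (inv_into U c y))" for y
    define G where "G z = e (g (inv_into U' c' z)) a" for z
    note inj' = chart_properties(3)[OF N c'(1)]
    have inv: "inv_into U c (c x) = x" if "x \<in> Q'" for x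
      using that inj by (simp add: Q'_def Q_def)
    have inv': "inv_into U' c' (c' (f x)) = f x" if "x \<in> Q'" for x
      using that inj' by (simp add: Q'_def Q_def)
    have "Ck (mdim M) k (\<lambda>y. G (F y)) (c ` Q')"
    proof (rule Ck_compose[where F = F and G = G, OF cQ' Ck_map_chart_domain_openin[OF N P g c'(1) e]])
      show "F ` c ` Q' \<subseteq> c' ` {x \<in> U' \<inter> T. g x \<in> W}"
        using inv fS by (auto simp: F_def) (auto simp: Q'_def Q_def)
      show "Ck (mdim M) k (\<lambda>y. F y j) (c ` Q')" if "j < mdim N" for j
        unfolding F_def
        by (rule Ck_subset[OF Ck_map_chart_domain_openin[OF M N f c c'(1)] cQ' _ Ck_map_charts[OF f c c'(1) that]])
          (auto simp: Q'_def Q_def)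
      show "Ck (mdim N) k G (c' ` {x \<in> U' \<inter> T. g x \<in> W})"
        unfolding G_def by (rule Ck_map_charts[OF g c'(1) e a])
    qed
    then have "Ck (mdim M) k (\<lambda>y. e (g (f (inv_into U c y))) a) (c ` Q')"
      by (rule Ck_cong_imp[OF cQ', rotated]) (auto simp: F_def G_def inv inv')
    then show "\<exists>B. openin (Euclidean_space (mdim M)) B \<and> y \<in> B \<and> B \<subseteq> c ` Q \<and>
        Ck (mdim M) k (\<lambda>y. e (g (f (inv_into U c y))) a) B"
      using cQ' x c'(2) by (intro exI[of _ "c ` Q'"]) (auto simp: Q'_def)
  qed
qed

lemma Ck_map_id:
  assumes M: "smooth_manifold M" and S: "openin (mtop M) S"
  shows "Ck_map k M S M (\<lambda>x. x)"
proof (rule Ck_mapI[OF S])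
  show "continuous_map (subtopology (mtop M) S) (mtop M) (\<lambda>x. x)"
    by (simp add: continuous_map_from_subtopology)
  fix U c U' c' a
  assume c: "(U, c) \<in> charts M" "(U', c') \<in> charts M" "a < mdim M"
  have o: "openin (Euclidean_space (mdim M)) (c ` (U \<inter> U'))" "openin (Euclidean_space (mdim M)) (c ` {x \<in> U \<inter> S. x \<in> U'})"
  proof -
    have "openin (mtop M) (U \<inter> U')" "openin (mtop M) (U \<inter> S \<inter> U')"
      by (intro openin_Int chart_properties(1)[OF M c(1)] chart_properties(1)[OF M c(2)] S)+
    moreover have "U \<inter> S \<inter> U' = {x \<in> U \<inter> S. x \<in> U'}" by blast
    ultimately show "openin (Euclidean_space (mdim M)) (c ` (U \<inter> U'))" "openin (Euclidean_space (mdim M)) (c ` {x \<in> U \<inter> S. x \<in> U'})"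
      by (auto intro!: chart_properties(6)[OF M c(1)])
  qed
  show "Ck (mdim M) k (\<lambda>y. c' (inv_into U c y) a) (c ` {x \<in> U \<inter> S. x \<in> U'})"
    by (rule Ck_subset[OF o _ chart_transition_Ck[OF M c]]) auto
qed

section \<open>Euclidean space as a manifold, and charts as C^k maps\<close>

lemma inv_into_id_eq: "y \<in> T \<Longrightarrow> inv_into T (\<lambda>x. x) y = y"
  by (metis inj_on_id2 inv_into_f_f)

lemma smooth_manifold_Rn: "smooth_manifold (Rn n)"
proof -
  let ?T = "topspace (Euclidean_space n)"
  have "second_countable (euclidean :: (nat \<Rightarrow> real) topology)"
  proof -
    obtain B :: "(nat \<Rightarrow> real) set set" where "countable B" "topological_basis B"
      using ex_countable_basis by blast
    moreover have "\<forall>V\<in>B. openin euclidean V"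
      using topological_basis_open[OF \<open>topological_basis B\<close>] by (simp add: open_openin[symmetric])
    moreover have "\<exists>V\<in>B. x \<in> V \<and> V \<subseteq> U" if "openin euclidean U \<and> x \<in> U" for U x
      using topological_basisE[OF \<open>topological_basis B\<close>, of U x] that by (metis open_openin)
    ultimately show ?thesis unfolding second_countable_def by blast
  qed
  then have "second_countable (Euclidean_space n)"
    unfolding Euclidean_space_eq by (rule second_countable_subtopology)
  moreover have "Hausdorff_space (Euclidean_space n)"
    unfolding Euclidean_space_eq by (simp add: Hausdorff_space_subtopology)
  \<comment> \<open>The only transition map of the atlas is the inverse of the identity chart. As an
    \<open>inv_into\<close> it is the identity on \<open>?T\<close> only, which is enough for
    \<open>Ck_cong_imp\<close>.\<close>
  moreover have "Ck n k (\<lambda>y. inv_into ?T (\<lambda>x. x) y a) ?T" for k a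
    by (rule Ck_cong_imp[OF _ _ Ck_coordinate]) (auto simp: inv_into_id_eq)
  moreover have "homeomorphic_map (Euclidean_space n) (Euclidean_space n) (\<lambda>x. x)"
    using homeomorphic_map_id[of "Euclidean_space n" "Euclidean_space n"] by (simp add: id_def)
  ultimately show ?thesis
    by (simp add: smooth_manifold_def Rn_def)
qed

lemma Rn_simps [simp]:
  "mtop (Rn n) = Euclidean_space n" "mdim (Rn n) = n"
  "charts (Rn n) = {(topspace (Euclidean_space n), \<lambda>x. x)}"
  by (simp_all add: Rn_def)

lemma Ck_map_translation:
  assumes S: "openin (Euclidean_space n) S" and t: "t \<in> topspace (Euclidean_space n)"
  shows "Ck_map k (Rn n) S (Rn n) (\<lambda>y i. y i + t i)"
proof (rule Ck_mapI)
  show "openin (mtop (Rn n)) S" using S by simp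
  show "continuous_map (subtopology (mtop (Rn n)) S) (mtop (Rn n)) (\<lambda>y i. y i + t i)"
    using t by (simp add: continuous_map_Euclidean_space_add continuous_map_from_subtopology)
  fix U U' :: "(nat \<Rightarrow> real) set" and c c' :: "(nat \<Rightarrow> real) \<Rightarrow> nat \<Rightarrow> real" and a
  assume "(U, c) \<in> charts (Rn n)" "(U', c') \<in> charts (Rn n)"
  then have c: "U = topspace (Euclidean_space n)" "c = (\<lambda>x. x)" "U' = U" "c' = c" by auto
  have "{x \<in> U \<inter> S. (\<lambda>i. x i + t i) \<in> U'} = S"
    using t openin_subset[OF S] unfolding c by (auto simp: topspace_Euclidean_space)
  moreover have "Ck n k (\<lambda>y. inv_into (topspace (Euclidean_space n)) (\<lambda>x. x) y a + t a) S"
    using openin_subset[OF S]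
    by (intro Ck_cong_imp[OF S _ Ck_add[OF S Ck_coordinate[OF S, of k a] Ck_const[OF S, of k "t a"]]])
      (auto simp: inv_into_id_eq)
  ultimately show "Ck (mdim (Rn n)) k (\<lambda>y. c' (\<lambda>i. inv_into U c y i + t i) a) (c ` {x \<in> U \<inter> S. (\<lambda>i. x i + t i) \<in> U'})"
    unfolding c by simp
qed

text \<open>Expressed in another chart of \<open>M\<close>, a chart is a coordinate change, and the
  atlas is smooth.\<close>

lemma Ck_map_chart:
  assumes M: "smooth_manifold M" and c: "(U, c) \<in> charts M"
  shows "Ck_map k M U (Rn (mdim M)) c"
proof (rule Ck_mapI[OF chart_properties(1)[OF M c]])
  show "continuous_map (subtopology (mtop M) U) (mtop (Rn (mdim M))) c"
    using chart_properties(4)[OF M c] by simp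
  fix U' c' W e a
  assume c': "(U', c') \<in> charts M" and e: "(W, e) \<in> charts (Rn (mdim M))" and a: "a < mdim (Rn (mdim M))"
  have "c ` U \<subseteq> topspace (Euclidean_space (mdim M))"
    using openin_subset[OF chart_properties(2)[OF M c]] .
  then have "{x \<in> U' \<inter> U. c x \<in> W} = U' \<inter> U" using e by auto
  then show "Ck (mdim M) k (\<lambda>y. e (c (inv_into U' c' y)) a) (c' ` {x \<in> U' \<inter> U. c x \<in> W})"
    using chart_transition_Ck[OF M c' c] a e by simp
qed

lemma Ck_map_chart_inverse:
  assumes M: "smooth_manifold M" and c: "(U, c) \<in> charts M"
  shows "Ck_map k (Rn (mdim M)) (c ` U) M (inv_into U c)"
proof (rule Ck_mapI)
  note cU = chart_properties(2)[OF M c]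
  show "openin (mtop (Rn (mdim M))) (c ` U)" using cU by simp
  show "continuous_map (subtopology (mtop (Rn (mdim M))) (c ` U)) (mtop M) (inv_into U c)"
    using chart_properties(5)[OF M c] by simp
  fix W e U' c' a
  assume e: "(W, e) \<in> charts (Rn (mdim M))" and c': "(U', c') \<in> charts M" and a: "a < mdim M"
  have sub: "c ` U \<subseteq> topspace (Euclidean_space (mdim M))"
    using openin_subset[OF cU] .
  have "{x \<in> topspace (Euclidean_space (mdim M)) \<inter> c ` U. inv_into U c x \<in> U'} = c ` (U \<inter> U')"
    using sub chart_properties(3)[OF M c] by auto
  moreover have "openin (Euclidean_space (mdim M)) (c ` (U \<inter> U'))"
    using chart_properties(1)[OF M c] chart_properties(1)[OF M c'] by (intro chart_properties(6)[OF M c]) auto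
  then have "Ck (mdim M) k (\<lambda>y. c' (inv_into U c (inv_into (topspace (Euclidean_space (mdim M))) (\<lambda>x. x) y)) a) (c ` (U \<inter> U'))"
  proof (rule Ck_cong_imp[OF _ _ chart_transition_Ck[OF M c c' a]])
    fix y assume "y \<in> c ` (U \<inter> U')"
    then have "inv_into (topspace (Euclidean_space (mdim M))) (\<lambda>x. x) y = y"
      using sub by (intro inv_into_id_eq) auto
    then show "c' (inv_into U c y) a
        = c' (inv_into U c (inv_into (topspace (Euclidean_space (mdim M))) (\<lambda>x. x) y)) a" by simp
  qed
  ultimately show "Ck (mdim (Rn (mdim M))) k (\<lambda>y. c' (inv_into U c (inv_into W e y)) a)
      (e ` {x \<in> W \<inter> c ` U. inv_into U c x \<in> U'})"
    using e by simp
qed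

subsection \<open>\<open>C\<^sup>k\<close> diffeomorphisms\<close>

lemma Ck_diffeoD:
  assumes "Ck_diffeo k M S N T f"
  shows "bij_betw f S T" and "inj_on f S" and "f ` S = T"
    and "Ck_map k M S N f" and "Ck_map k N T M (inv_into S f)"
    and "\<And>x. x \<in> S \<Longrightarrow> f x \<in> T" and "\<And>x. x \<in> S \<Longrightarrow> inv_into S f (f x) = x"
    and "\<And>y. y \<in> T \<Longrightarrow> inv_into S f y \<in> S" and "\<And>y. y \<in> T \<Longrightarrow> f (inv_into S f y) = y"
proof -
  show b: "bij_betw f S T" and "Ck_map k M S N f" and "Ck_map k N T M (inv_into S f)"
    using assms by (simp_all add: Ck_diffeo_def)
  show inj: "inj_on f S" and im: "f ` S = T" using b by (simp_all add: bij_betw_def)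
  show "f x \<in> T" if "x \<in> S" for x using im that by blast
  show "inv_into S f (f x) = x" if "x \<in> S" for x by (rule inv_into_f_f[OF inj that])
  show "inv_into S f y \<in> S" if "y \<in> T" for y
    using that unfolding im[symmetric] by (rule inv_into_into)
  show "f (inv_into S f y) = y" if "y \<in> T" for y
    using that unfolding im[symmetric] by (rule f_inv_into_f)
qed

text \<open>\<open>Ck_diffeo\<close> insists on \<open>inv_into S f\<close> as the inverse. A
  two-sided inverse \<open>g\<close> agrees with it on \<open>T\<close>, and by
  \<open>Ck_map_cong\<close> only the values on \<open>T\<close> matter.\<close>

lemma Ck_diffeoI:
  assumes "smooth_manifold M" and "smooth_manifold N"
    and "Ck_map k M S N f" and "Ck_map k N T M g" and "f ` S \<subseteq> T" and "g ` T \<subseteq> S"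
    and gf: "\<And>x. x \<in> S \<Longrightarrow> g (f x) = x" and fg: "\<And>y. y \<in> T \<Longrightarrow> f (g y) = y"
  shows "Ck_diffeo k M S N T f"
proof -
  have b: "bij_betw f S T"
    using assms(5-) by (intro bij_betw_byWitness[where f' = g]) auto
  have "g y = inv_into S f y" if "y \<in> T" for y
    using that b assms(6) fg by (metis bij_betw_inv_into_left image_subset_iff)
  then have "Ck_map k N T M (inv_into S f)"
    by (rule Ck_map_cong[OF assms(2,1,4)])
  then show ?thesis using b assms(3) by (simp add: Ck_diffeo_def)
qed

lemma Ck_diffeo_inv_into:
  assumes "smooth_manifold M" and "smooth_manifold N" and f: "Ck_diffeo k M S N T f"
  shows "Ck_diffeo k N T M S (inv_into S f)"
  by (rule Ck_diffeoI[OF assms(2,1) Ck_diffeoD(5,4)[OF f]])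
    (simp_all add: image_subset_iff Ck_diffeoD[OF f])

lemma Ck_diffeo_compose:
  assumes M: "smooth_manifold M" and N: "smooth_manifold N" and P: "smooth_manifold P"
    and f: "Ck_diffeo k M S N T f" and g: "Ck_diffeo k N T P R g"
  shows "Ck_diffeo k M S P R (\<lambda>x. g (f x))"
proof (rule Ck_diffeoI[OF M P])
  note F = Ck_diffeoD[OF f] and G = Ck_diffeoD[OF g]
  show "Ck_map k M S P (\<lambda>x. g (f x))"
    by (rule Ck_map_compose[OF M N P F(4) G(4)]) (simp add: F)
  show "Ck_map k P R M (\<lambda>z. inv_into S f (inv_into T g z))"
    by (rule Ck_map_compose[OF P N M G(5) F(5)]) (simp add: image_subset_iff G)
qed (simp_all add: image_subset_iff Ck_diffeoD[OF f] Ck_diffeoD[OF g])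

lemma Ck_diffeo_cong:
  assumes M: "smooth_manifold M" and N: "smooth_manifold N" and f: "Ck_diffeo k M S N T f"
    and eq: "\<And>x. x \<in> S \<Longrightarrow> f x = g x"
  shows "Ck_diffeo k M S N T g"
proof (rule Ck_diffeoI[OF M N])
  show "Ck_map k M S N g" by (rule Ck_map_cong[OF M N Ck_diffeoD(4)[OF f] eq])
  show "Ck_map k N T M (inv_into S f)" by (rule Ck_diffeoD(5)[OF f])
qed (simp_all add: image_subset_iff Ck_diffeoD[OF f] eq[symmetric])

lemma Ck_diffeo_mono:
  "smooth_manifold M \<Longrightarrow> smooth_manifold N \<Longrightarrow> k \<le> r \<Longrightarrow> Ck_diffeo r M S N T f \<Longrightarrow> Ck_diffeo k M S N T f"
  unfolding Ck_diffeo_def by (simp add: Ck_map_mono[of M N k r] Ck_map_mono[of N M k r])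

lemma Ck_diffeo_image_openin:
  assumes f: "Ck_diffeo k M S N T f" and B: "openin (mtop M) B" "B \<subseteq> S"
  shows "openin (mtop N) (f ` B)"
proof -
  note F = Ck_diffeoD[OF f]
  have "f ` B = {y \<in> T. inv_into S f y \<in> B}"
  proof (intro equalityI subsetI)
    fix y assume "y \<in> f ` B"
    then show "y \<in> {y \<in> T. inv_into S f y \<in> B}" using F(6,7) B(2) by auto
  next
    fix y assume "y \<in> {y \<in> T. inv_into S f y \<in> B}"
    then show "y \<in> f ` B" using F(9)[of y] by (metis (no_types, lifting) image_eqI mem_Collect_eq)
  qed
  then show ?thesis using Ck_map_preimage_openin[OF F(5) B(1)] by simp
qed

lemma Ck_diffeo_subset:
  assumes M: "smooth_manifold M" and N: "smooth_manifold N" and f: "Ck_diffeo k M S N T f"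
    and B: "openin (mtop M) B" "B \<subseteq> S"
  shows "Ck_diffeo k M B N (f ` B) f"
proof (rule Ck_diffeoI[OF M N])
  note F = Ck_diffeoD[OF f]
  show "Ck_map k M B N f" by (rule Ck_map_subset[OF M N F(4) B])
  have "f ` B \<subseteq> T" using F(6) B(2) by blast
  then show "Ck_map k N (f ` B) M (inv_into S f)"
    by (rule Ck_map_subset[OF N M F(5) Ck_diffeo_image_openin[OF f B]])
  show "inv_into S f (f x) = x" if "x \<in> B" for x
    using that F(7) B(2) by blast
  then show "f (inv_into S f y) = y" if "y \<in> f ` B" for y
    using that by force
  show "inv_into S f ` f ` B \<subseteq> B"
    using F(7) subsetD[OF B(2)] by auto
qed simp

lemma Ck_diffeo_id:
  assumes "smooth_manifold M"
  shows "Ck_diffeo k M (mpoints M) M (mpoints M) (\<lambda>x. x)"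
  by (rule Ck_diffeoI[OF assms assms Ck_map_id[OF assms] Ck_map_id[OF assms]]) auto

lemma Ck_diffeo_translation:
  assumes t: "t \<in> topspace (Euclidean_space n)"
  shows "Ck_diffeo k (Rn n) (topspace (Euclidean_space n)) (Rn n) (topspace (Euclidean_space n)) (\<lambda>y i. y i + t i)"
proof (rule Ck_diffeoI[OF smooth_manifold_Rn smooth_manifold_Rn])
  have t': "(\<lambda>i. - t i) \<in> topspace (Euclidean_space n)"
    using t by (simp add: topspace_Euclidean_space)
  show "Ck_map k (Rn n) (topspace (Euclidean_space n)) (Rn n) (\<lambda>y i. y i + t i)"
    "Ck_map k (Rn n) (topspace (Euclidean_space n)) (Rn n) (\<lambda>y i. y i + - t i)"
    by (rule Ck_map_translation[OF openin_topspace t], rule Ck_map_translation[OF openin_topspace t'])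
qed (use t in \<open>auto simp: topspace_Euclidean_space\<close>)

section \<open>The group of C^r diffeomorphisms\<close>

lemma Diff_memD:
  assumes "f \<in> Diff r M"
  shows "f \<in> Bij (mpoints M)" and "Ck_diffeo r M (mpoints M) M (mpoints M) f"
    and "bij_betw f (mpoints M) (mpoints M)" and "f \<in> extensional (mpoints M)"
  using assms by (auto simp: Diff_def Bij_def)

text \<open>Unit, product and inverse of \<open>BijGroup\<close> are restrictions to
  \<open>mpoints M\<close> of the identity, the composite and \<open>inv_into\<close>.
  \<open>Ck_diffeo_cong\<close> passes from the plain maps to the restricted ones.\<close>

lemma subgroup_Diff:
  assumes M: "smooth_manifold M"
  shows "subgroup (Diff r M) (BijGroup (mpoints M))"
proof
  show "Diff r M \<subseteq> carrier (BijGroup (mpoints M))"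
    by (auto simp: Diff_def BijGroup_def)
  show "\<one>\<^bsub>BijGroup (mpoints M)\<^esub> \<in> Diff r M"
    using Ck_diffeo_cong[OF M M Ck_diffeo_id[OF M], of "\<lambda>x\<in>mpoints M. x"] id_Bij
    by (auto simp: Diff_def BijGroup_def)
next
  fix f g assume fg: "f \<in> Diff r M" "g \<in> Diff r M"
  have "Ck_diffeo r M (mpoints M) M (mpoints M) (compose (mpoints M) f g)"
    by (rule Ck_diffeo_cong[OF M M Ck_diffeo_compose[OF M M M Diff_memD(2)[OF fg(2)] Diff_memD(2)[OF fg(1)]]])
      (simp add: compose_eq)
  then show "f \<otimes>\<^bsub>BijGroup (mpoints M)\<^esub> g \<in> Diff r M"
    using fg compose_Bij by (auto simp: Diff_def BijGroup_def)
next
  fix f assume f: "f \<in> Diff r M"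
  have "Ck_diffeo r M (mpoints M) M (mpoints M) (\<lambda>x\<in>mpoints M. inv_into (mpoints M) f x)"
    by (rule Ck_diffeo_cong[OF M M Ck_diffeo_inv_into[OF M M Diff_memD(2)[OF f]]]) simp
  then show "inv\<^bsub>BijGroup (mpoints M)\<^esub> f \<in> Diff r M"
    using f restrict_inv_into_Bij[OF Diff_memD(1)[OF f]] by (simp add: Diff_def inv_BijGroup)
qed

subsection \<open>Frames\<close>

abbreviation frame_of :: "nat \<Rightarrow> 'a manifold \<Rightarrow> ((nat \<Rightarrow> real) \<Rightarrow> 'a) \<Rightarrow> ((nat \<Rightarrow> real) \<Rightarrow> 'a) set" where
  "frame_of k M \<phi> \<equiv> frame_rel k M `` {\<phi>}"

lemma local_paramsI: "origin \<in> W \<Longrightarrow> Ck_diffeo k (Rn (mdim M)) W M S \<phi> \<Longrightarrow> \<phi> \<in> local_params k M"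
  unfolding local_params_def by blast

lemma local_paramsE:
  assumes "\<phi> \<in> local_params k M"
  obtains W S where "origin \<in> W" and "Ck_diffeo k (Rn (mdim M)) W M S \<phi>"
  using assms unfolding local_params_def by blast

lemma frame_rel_iff:
  "(\<phi>, \<psi>) \<in> frame_rel k M \<longleftrightarrow>
    \<phi> \<in> local_params k M \<and> \<psi> \<in> local_params k M \<and> \<phi> origin = \<psi> origin \<and>
    (\<forall>U c. (U, c) \<in> charts M \<longrightarrow> \<phi> origin \<in> U \<longrightarrow>
      jet (mdim M) k (c \<circ> \<phi>) origin = jet (mdim M) k (c \<circ> \<psi>) origin)"
  unfolding frame_rel_def by fast

text \<open>Jets are compared in all charts around the common base point at once, so symmetry and
  transitivity reduce to those of equality.\<close>

lemma equiv_frame_rel: "equiv (local_params k M) (frame_rel k M)"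
proof (rule equivI)
  show "frame_rel k M \<subseteq> local_params k M \<times> local_params k M"
    by (auto simp: frame_rel_iff)
  show "refl_on (local_params k M) (frame_rel k M)"
    by (auto simp: frame_rel_iff refl_on_def)
  show "sym (frame_rel k M)"
    by (rule symI) (simp add: frame_rel_iff)
  show "trans (frame_rel k M)"
    by (rule transI) (simp add: frame_rel_iff)
qed

lemma frame_of_eq_iff:
  assumes "\<phi> \<in> local_params k M" and "\<psi> \<in> local_params k M"
  shows "frame_of k M \<phi> = frame_of k M \<psi> \<longleftrightarrow> (\<phi>, \<psi>) \<in> frame_rel k M"
  using eq_equiv_class_iff[OF equiv_frame_rel assms] .

lemma frame_of_in_frames: "\<phi> \<in> local_params k M \<Longrightarrow> frame_of k M \<phi> \<in> frames k M"
  unfolding frames_def by (rule quotientI)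

lemma framesE:
  assumes "p \<in> frames k M"
  obtains \<phi> where "\<phi> \<in> local_params k M" and "p = frame_of k M \<phi>"
  using assms unfolding frames_def by (rule quotientE)

lemma Ck_in_chart:
  assumes M: "smooth_manifold M" and \<phi>: "Ck_map k (Rn (mdim M)) W M \<phi>" and c: "(U, c) \<in> charts M"
  shows "openin (Euclidean_space (mdim M)) {y \<in> W. \<phi> y \<in> U}"
    and "a < mdim M \<Longrightarrow> Ck (mdim M) k (\<lambda>y. c (\<phi> y) a) {y \<in> W. \<phi> y \<in> U}"
proof -
  let ?E = "Euclidean_space (mdim M)"
  show o: "openin ?E {y \<in> W. \<phi> y \<in> U}"
    using Ck_map_preimage_openin[OF \<phi> chart_properties(1)[OF M c]] by simp
  have W: "W \<subseteq> topspace ?E" using openin_subset[OF Ck_map_openin[OF \<phi>]] by simp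
  then have dom: "{x \<in> topspace ?E \<inter> W. \<phi> x \<in> U} = {y \<in> W. \<phi> y \<in> U}" by blast
  assume a: "a < mdim M"
  have "Ck (mdim M) k (\<lambda>y. c (\<phi> (inv_into (topspace ?E) (\<lambda>x. x) y)) a) {y \<in> W. \<phi> y \<in> U}"
    using Ck_map_charts[OF \<phi> _ c a, of "topspace ?E" "\<lambda>x. x"] dom by simp
  then show "Ck (mdim M) k (\<lambda>y. c (\<phi> y) a) {y \<in> W. \<phi> y \<in> U}"
  proof (rule Ck_cong_imp[OF o, rotated])
    fix y assume "y \<in> {y \<in> W. \<phi> y \<in> U}"
    then have "inv_into (topspace ?E) (\<lambda>x. x) y = y" using W by (intro inv_into_id_eq) auto
    then show "c (\<phi> (inv_into (topspace ?E) (\<lambda>x. x) y)) a = c (\<phi> y) a" by simp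
  qed
qed

text \<open>A frame depends only on the germ of its parametrisation. This converts agreement of two
  diffeomorphisms on an open set into equality of the frames they produce.\<close>

lemma frame_of_eq_local:
  assumes "\<phi> \<in> local_params k M" and "\<psi> \<in> local_params k M"
    and B: "openin (Euclidean_space (mdim M)) B" "origin \<in> B" and eq: "\<And>y. y \<in> B \<Longrightarrow> \<phi> y = \<psi> y"
  shows "frame_of k M \<phi> = frame_of k M \<psi>"
proof -
  have "jet (mdim M) k (c \<circ> \<phi>) origin = jet (mdim M) k (c \<circ> \<psi>) origin" for c
    unfolding jet_eq_iff_jet using eq by (intro allI impI jet_eq_local[OF B]) simp
  then have "(\<phi>, \<psi>) \<in> frame_rel k M"
    using assms eq[OF B(2)] by (auto simp: frame_rel_def)
  then show ?thesis using frame_of_eq_iff assms by blast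
qed

text \<open>The generators of the topology of the frame bundle ask for some representative of the
  class. All representatives have the same base point and jet coordinates, so the condition can be
  tested on the given one.\<close>

lemma frame_in_chart_iff:
  assumes "\<phi> \<in> local_params k M" and c: "(U, c) \<in> charts M"
  shows "(\<exists>\<psi> \<in> frame_of k M \<phi>. \<psi> origin \<in> U \<and> jet (mdim M) k (c \<circ> \<psi>) origin \<in> Q) \<longleftrightarrow>
    \<phi> origin \<in> U \<and> jet (mdim M) k (c \<circ> \<phi>) origin \<in> Q"
proof -
  have "\<psi> origin = \<phi> origin \<and> (\<phi> origin \<in> U \<longrightarrow> jet (mdim M) k (c \<circ> \<psi>) origin = jet (mdim M) k (c \<circ> \<phi>) origin)"
    if "\<psi> \<in> frame_of k M \<phi>" for \<psi>
    using that c by (force simp: frame_rel_def)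
  moreover have "\<phi> \<in> frame_of k M \<phi>"
    using assms by (auto simp: frame_rel_def)
  ultimately show ?thesis by metis
qed

text \<open>Recentring at \<open>t\<close> yields a frame over \<open>\<phi> t\<close>; its domain
  \<open>W'\<close> is \<open>W\<close> shifted by \<open>-t\<close>. In this way one
  parametrisation provides a family of frames indexed by \<open>W\<close>.\<close>

lemma local_params_translate:
  assumes M: "smooth_manifold M" and \<phi>: "Ck_diffeo k (Rn (mdim M)) W M S \<phi>" and t: "t \<in> W"
  shows "(\<lambda>y. \<phi> (\<lambda>i. y i + t i)) \<in> local_params k M"
proof -
  let ?T = "topspace (Euclidean_space (mdim M))"
  let ?\<tau> = "\<lambda>y i. y i + t i"
  define W' where "W' = {y \<in> ?T. ?\<tau> y \<in> W}"
  have W: "openin (Euclidean_space (mdim M)) W"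
    using Ck_map_openin[OF Ck_diffeoD(4)[OF \<phi>]] by simp
  have tT: "t \<in> ?T" using t openin_subset[OF W] by blast
  note \<tau> = Ck_diffeo_translation[OF tT, of k]
  have W': "openin (Euclidean_space (mdim M)) W'"
    using Ck_map_preimage_openin[OF Ck_diffeoD(4)[OF \<tau>]] W by (simp add: W'_def)
  have "?\<tau> ` W' = W"
  proof
    show "W \<subseteq> ?\<tau> ` W'"
    proof
      fix w assume w: "w \<in> W"
      then have "(\<lambda>i. w i - t i) \<in> ?T"
        using tT openin_subset[OF W] by (auto simp: topspace_Euclidean_space)
      then show "w \<in> ?\<tau> ` W'" using w by (intro image_eqI[of _ _ "\<lambda>i. w i - t i"]) (auto simp: W'_def)
    qed
  qed (auto simp: W'_def)
  moreover have "Ck_diffeo k (Rn (mdim M)) W' (Rn (mdim M)) (?\<tau> ` W') ?\<tau>"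
    using W' by (intro Ck_diffeo_subset[OF smooth_manifold_Rn smooth_manifold_Rn \<tau>]) (auto simp: W'_def)
  ultimately have "Ck_diffeo k (Rn (mdim M)) W' M S (\<lambda>y. \<phi> (?\<tau> y))"
    using Ck_diffeo_compose[OF smooth_manifold_Rn smooth_manifold_Rn M _ \<phi>] by simp
  moreover have "origin \<in> W'" using t by (simp add: W'_def topspace_Euclidean_space)
  ultimately show ?thesis by (rule local_paramsI[rotated])
qed

section \<open>The action of diffeomorphisms on frames\<close>

lemma Diff_compose_param:
  assumes M: "smooth_manifold M" and g: "g \<in> Diff r M" and k: "k \<le> r"
    and \<phi>: "Ck_diffeo k (Rn (mdim M)) W M S \<phi>"
  shows "Ck_diffeo k (Rn (mdim M)) W M (g ` S) (\<lambda>y. g (\<phi> y))"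
proof -
  have S: "openin (mtop M) S" by (rule Ck_map_openin[OF Ck_diffeoD(5)[OF \<phi>]])
  have "Ck_diffeo k M (mpoints M) M (mpoints M) g"
    by (rule Ck_diffeo_mono[OF M M k Diff_memD(2)[OF g]])
  from Ck_diffeo_subset[OF M M this S openin_subset[OF S]]
  show ?thesis by (rule Ck_diffeo_compose[OF smooth_manifold_Rn M M \<phi>])
qed

lemma Diff_compose_local_params:
  assumes "smooth_manifold M" and "g \<in> Diff r M" and "k \<le> r" and "\<phi> \<in> local_params k M"
  shows "(\<lambda>y. g (\<phi> y)) \<in> local_params k M"
  using local_paramsE[OF assms(4)] Diff_compose_param[OF assms(1-3)] local_paramsI by metis

text \<open>With a chart \<open>c\<close> around the base point,
  \<open>c' \<circ> g \<circ> \<phi>\<close> is the coordinate expression of \<open>g\<close>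
  composed with \<open>c \<circ> \<phi>\<close>. Hence its jet depends only on the jet of
  \<open>c \<circ> \<phi>\<close>, by \<open>jet_eq_compose\<close>.\<close>

lemma frame_rel_compose:
  assumes M: "smooth_manifold M" and g: "g \<in> Diff r M" and k: "k \<le> r"
    and rel: "(\<phi>, \<psi>) \<in> frame_rel k M"
  shows "((\<lambda>y. g (\<phi> y)), (\<lambda>y. g (\<psi> y))) \<in> frame_rel k M"
proof -
  let ?E = "Euclidean_space (mdim M)"
  have lp: "\<phi> \<in> local_params k M" "\<psi> \<in> local_params k M" and eq0: "\<phi> origin = \<psi> origin"
    and jets: "\<And>U c. (U, c) \<in> charts M \<Longrightarrow> \<phi> origin \<in> U \<Longrightarrow>
      jet (mdim M) k (c \<circ> \<phi>) origin = jet (mdim M) k (c \<circ> \<psi>) origin"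
    using rel unfolding frame_rel_def by auto
  obtain W S where W: "origin \<in> W" "Ck_diffeo k (Rn (mdim M)) W M S \<phi>"
    using local_paramsE[OF lp(1)] .
  obtain W' S' where W': "origin \<in> W'" "Ck_diffeo k (Rn (mdim M)) W' M S' \<psi>"
    using local_paramsE[OF lp(2)] .
  note phi = Ck_diffeoD(4)[OF W(2)] and psi = Ck_diffeoD(4)[OF W'(2)]
  have gd: "Ck_map k M (mpoints M) M g"
    by (rule Ck_map_mono[OF M M k Ck_diffeoD(4)[OF Diff_memD(2)[OF g]]])
  have "jet (mdim M) k (c' \<circ> (\<lambda>y. g (\<phi> y))) origin = jet (mdim M) k (c' \<circ> (\<lambda>y. g (\<psi> y))) origin"
    if c': "(U', c') \<in> charts M" and gU': "g (\<phi> origin) \<in> U'" for U' c'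
  proof -
    obtain U c where c: "(U, c) \<in> charts M" "\<phi> origin \<in> U"
      using chart_at[OF M Ck_map_into[OF phi W(1)]] .
    define P where "P = {x \<in> U \<inter> mpoints M. g x \<in> U'}"
    have "openin (mtop M) (U \<inter> {x \<in> mpoints M. g x \<in> U'})"
      by (intro openin_Int chart_properties(1)[OF M c(1)] Ck_map_preimage_openin[OF gd] chart_properties(1)[OF M c'])
    moreover have "U \<inter> {x \<in> mpoints M. g x \<in> U'} = P" by (auto simp: P_def)
    ultimately have P: "openin (mtop M) P" by simp
    have PU: "P \<subseteq> U" by (auto simp: P_def)
    \<comment> \<open>\<open>B\<close> is a common neighbourhood of the origin on which both
      parametrisations land in \<open>P\<close>, where the coordinate expression of \<open>g\<close>
      between the two charts is defined.\<close>
    define B where "B = {y \<in> W. \<phi> y \<in> P} \<inter> {y \<in> W'. \<psi> y \<in> P}"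
    have B: "openin ?E B"
      using Ck_map_preimage_openin[OF phi P] Ck_map_preimage_openin[OF psi P] by (auto simp: B_def)
    have "\<phi> origin \<in> P"
      using c(2) gU' Ck_map_into[OF phi W(1)] by (simp add: P_def)
    then have B0: "origin \<in> B" using W(1) W'(1) eq0 by (simp add: B_def)
    note inj = chart_properties(3)[OF M c(1)]
    show ?thesis
      unfolding jet_eq_iff_jet
    proof (intro allI impI)
      fix a assume a: "a < mdim M"
      define G where "G z = c' (g (inv_into U c z)) a" for z
      have inv: "inv_into U c (c x) = x" if "x \<in> P" for x
        using inj that PU by (intro inv_into_f_f) auto
      show "jet_eq (mdim M) k (\<lambda>y. (c' \<circ> (\<lambda>y. g (\<phi> y))) y a) (\<lambda>y. (c' \<circ> (\<lambda>y. g (\<psi> y))) y a) origin"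
      proof (rule jet_eq_cong[OF B B0])
        show "(c' \<circ> (\<lambda>y. g (\<phi> y))) y a = G (c (\<phi> y))" "(c' \<circ> (\<lambda>y. g (\<psi> y))) y a = G (c (\<psi> y))" if "y \<in> B" for y
          using that by (auto simp: G_def B_def inv)
        show "jet_eq (mdim M) k (\<lambda>y. G (c (\<phi> y))) (\<lambda>y. G (c (\<psi> y))) origin"
        proof (rule jet_eq_compose[where F = "\<lambda>y. c (\<phi> y)" and F' = "\<lambda>y. c (\<psi> y)" and G = G,
              OF B chart_properties(6)[OF M c(1) P PU] _ _ B0])
          show "(\<lambda>y. c (\<phi> y)) ` B \<subseteq> c ` P" "(\<lambda>y. c (\<psi> y)) ` B \<subseteq> c ` P"
            by (auto simp: B_def)
          show "Ck (mdim M) k (\<lambda>y. c (\<phi> y) j) B" if "j < mdim M" for j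
            using PU by (intro Ck_subset[OF Ck_in_chart(1)[OF M phi c(1)] B _ Ck_in_chart(2)[OF M phi c(1) that]])
              (auto simp: B_def)
          show "Ck (mdim M) k (\<lambda>y. c (\<psi> y) j) B" if "j < mdim M" for j
            using PU by (intro Ck_subset[OF Ck_in_chart(1)[OF M psi c(1)] B _ Ck_in_chart(2)[OF M psi c(1) that]])
              (auto simp: B_def)
          show "Ck (mdim M) k G (c ` P)"
            using Ck_map_charts[OF gd c(1) c' a] unfolding G_def P_def .
          show "jet_eq (mdim M) k (\<lambda>y. c (\<phi> y) j) (\<lambda>y. c (\<psi> y) j) origin" if "j < mdim M" for j
            using jets[OF c] that unfolding jet_eq_iff_jet by simp
        qed
      qed
    qed
  qed
  then show ?thesis
    using eq0 Diff_compose_local_params[OF M g k lp(1)] Diff_compose_local_params[OF M g k lp(2)]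
    unfolding frame_rel_def by auto
qed

text \<open>\<open>prolong\<close> takes the union of the classes obtained from all representatives;
  by \<open>frame_rel_compose\<close> they are one and the same class.\<close>

lemma prolong_frame_of:
  assumes M: "smooth_manifold M" and g: "g \<in> Diff r M" and k: "k \<le> r" and \<phi>: "\<phi> \<in> local_params k M"
  shows "prolong k M g (frame_of k M \<phi>) = frame_of k M (\<lambda>y. g (\<phi> y))"
proof -
  have "frame_of k M (g \<circ> \<psi>) = frame_of k M (\<lambda>y. g (\<phi> y))" if "\<psi> \<in> frame_of k M \<phi>" for \<psi>
    using equiv_class_eq[OF equiv_frame_rel frame_rel_compose[OF M g k, of \<phi> \<psi>]] that
    by (simp add: o_def)
  moreover have "\<phi> \<in> frame_of k M \<phi>"
    using equiv_class_self[OF equiv_frame_rel \<phi>] .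
  ultimately have "(\<Union>\<psi> \<in> frame_of k M \<phi>. frame_of k M (g \<circ> \<psi>)) = frame_of k M (\<lambda>y. g (\<phi> y))"
    by blast
  moreover have "prolong k M g (frame_of k M \<phi>) = (\<Union>\<psi> \<in> frame_of k M \<phi>. frame_of k M (g \<circ> \<psi>))"
    unfolding prolong_def by blast
  ultimately show ?thesis by simp
qed

text \<open>By \<open>jet_translate\<close>, the preimage of a generator of the topology consists of
  the \<open>t \<in> W\<close> with \<open>\<phi> t \<in> U\<close> and the jet of
  \<open>c \<circ> \<phi>\<close> at \<open>t\<close> in \<open>Q\<close>. This set is open because
  jets of C^k maps vary continuously.\<close>

lemma continuous_map_moving_frame:
  assumes M: "smooth_manifold M" and \<phi>: "Ck_diffeo k (Rn (mdim M)) W M S \<phi>"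
  shows "continuous_map (subtopology (Euclidean_space (mdim M)) W) (frame_bundle k M)
    (\<lambda>t. frame_of k M (\<lambda>y. \<phi> (\<lambda>i. y i + t i)))"
  unfolding frame_bundle_def
proof (rule continuous_on_generated_topo)
  let ?E = "Euclidean_space (mdim M)"
  let ?F = "\<lambda>t. frame_of k M (\<lambda>y. \<phi> (\<lambda>i. y i + t i))"
  let ?gen = "{{p \<in> frames k M. \<exists>\<phi>\<in>p. \<phi> origin \<in> U \<and> jet (mdim M) k (c \<circ> \<phi>) origin \<in> Q} | U c Q.
       (U, c) \<in> charts M \<and> open Q}"
  note phi = Ck_diffeoD(4)[OF \<phi>]
  have W: "openin ?E W" using Ck_map_openin[OF phi] by simp
  then have tW: "topspace (subtopology ?E W) = W"
    using openin_subset by (blast intro!: topspace_subtopology_subset)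
  have F_iff: "?F t \<in> {p \<in> frames k M. \<exists>\<phi>\<in>p. \<phi> origin \<in> U \<and> jet (mdim M) k (c \<circ> \<phi>) origin \<in> Q}
      \<longleftrightarrow> \<phi> t \<in> U \<and> jet (mdim M) k (c \<circ> \<phi>) t \<in> Q"
    if t: "t \<in> W" and c: "(U, c) \<in> charts M" for t U c Q
  proof -
    note lp = local_params_translate[OF M \<phi> t]
    have "jet (mdim M) k (c \<circ> (\<lambda>y. \<phi> (\<lambda>i. y i + t i))) origin = jet (mdim M) k (c \<circ> \<phi>) t"
      using jet_translate[of "mdim M" k "c \<circ> \<phi>" t origin] by (simp add: o_def)
    then show ?thesis
      using frame_in_chart_iff[OF lp c, of Q] frame_of_in_frames[OF lp] by simp
  qed
  show "openin (subtopology ?E W) (?F -` X \<inter> topspace (subtopology ?E W))" if X: "X \<in> ?gen" for X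
  proof -
    obtain U c Q where c: "(U, c) \<in> charts M" and Q: "open Q"
      and X: "X = {p \<in> frames k M. \<exists>\<phi>\<in>p. \<phi> origin \<in> U \<and> jet (mdim M) k (c \<circ> \<phi>) origin \<in> Q}"
      using X by blast
    define B where "B = {y \<in> W. \<phi> y \<in> U}"
    have B: "openin ?E B" unfolding B_def by (rule Ck_in_chart(1)[OF M phi c])
    have "continuous_on B (jet (mdim M) k (c \<circ> \<phi>))"
      using Ck_in_chart(2)[OF M phi c] by (intro continuous_on_jet[OF B]) (simp add: B_def)
    then have "openin (top_of_set B) (B \<inter> jet (mdim M) k (c \<circ> \<phi>) -` Q)"
      using Q by (rule continuous_openin_preimage_gen)
    moreover have "top_of_set B = subtopology ?E B"
      using openin_subset[OF B] by (simp add: Euclidean_space_eq subtopology_subtopology Int_absorb1 topspace_Euclidean_space)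
    ultimately have "openin ?E (B \<inter> jet (mdim M) k (c \<circ> \<phi>) -` Q)"
      using B openin_trans_full by metis
    moreover have "?F -` X \<inter> W = B \<inter> jet (mdim M) k (c \<circ> \<phi>) -` Q"
      unfolding X using F_iff[OF _ c, of _ Q] by (auto simp: B_def)
    moreover have "B \<subseteq> W" by (auto simp: B_def)
    ultimately show ?thesis unfolding tW using W by (auto simp: openin_open_subtopology)
  qed
  \<comment> \<open>The space of a generated topology is the union of its generators, so every frame
    of the family must lie in one of them; \<open>Q = UNIV\<close> over a chart at the base point
    provides it.\<close>
  show "?F ` topspace (subtopology ?E W) \<subseteq> \<Union>?gen"
  proof
    fix p assume "p \<in> ?F ` topspace (subtopology ?E W)"
    then obtain t where t: "t \<in> W" "p = ?F t" unfolding tW by blast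
    obtain U c where c: "(U, c) \<in> charts M" "\<phi> t \<in> U"
      using chart_at[OF M Ck_map_into[OF phi t(1)]] .
    then have "p \<in> {p \<in> frames k M. \<exists>\<phi>\<in>p. \<phi> origin \<in> U \<and> jet (mdim M) k (c \<circ> \<phi>) origin \<in> UNIV}"
      using F_iff[OF t(1) c(1), of UNIV] t(2) by simp
    then show "p \<in> \<Union>?gen" using c(1) open_UNIV by blast
  qed
qed

lemma frame_at_point:
  assumes M: "smooth_manifold M" and x: "x \<in> mpoints M"
  obtains \<phi> where "\<phi> \<in> local_params k M" and "\<phi> origin = x"
proof -
  obtain U c where c: "(U, c) \<in> charts M" "x \<in> U" using chart_at[OF M x] .
  have "Ck_diffeo k M U (Rn (mdim M)) (c ` U) c"
    using chart_properties(3)[OF M c(1)]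
    by (intro Ck_diffeoI[OF M smooth_manifold_Rn Ck_map_chart[OF M c(1)] Ck_map_chart_inverse[OF M c(1)]]) auto
  then have "Ck_diffeo k (Rn (mdim M)) (c ` U) M U (inv_into U c)"
    by (rule Ck_diffeo_inv_into[OF M smooth_manifold_Rn])
  from local_params_translate[OF M this, of "c x"] c(2)
  have "(\<lambda>y. inv_into U c (\<lambda>i. y i + c x i)) \<in> local_params k M" by simp
  moreover have "inv_into U c (\<lambda>i. 0 + c x i) = x"
    using c chart_properties(3)[OF M c(1)] by simp
  ultimately show thesis using that by blast
qed

subsection \<open>Diffeomorphisms that agree pointwise with a countable group\<close>

text \<open>The coincidence sets \<open>F \<gamma>\<close> are closed and cover the space. If none
  had an interior point in \<open>U\<close>, the sets \<open>F \<gamma>\<close> without their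
  interiors would cover \<open>U\<close>; these are countably many closed sets with empty interior,
  against Baire's theorem.\<close>

lemma pointwise_agreement_dense:
  assumes X: "compact_space X" "Hausdorff_space X" and \<Gamma>: "countable \<Gamma>"
    and cont: "\<forall>\<gamma>\<in>\<Gamma>. continuous_map X X \<gamma>" and g: "continuous_map X X g"
    and pointwise: "\<forall>x\<in>topspace X. \<exists>\<gamma>\<in>\<Gamma>. g x = \<gamma> x"
    and U: "openin X U" "U \<noteq> {}"
  obtains \<gamma> U' where "\<gamma> \<in> \<Gamma>" and "openin X U'" and "U' \<noteq> {}" and "U' \<subseteq> U"
    and "\<forall>x\<in>U'. g x = \<gamma> x"
proof -
  define F where "F \<gamma> = {x \<in> topspace X. g x = \<gamma> x}" for \<gamma>
  have closed: "closedin X (F \<gamma>)" if "\<gamma> \<in> \<Gamma>" for \<gamma>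
    unfolding F_def by (rule closedin_continuous_maps_eq[OF X(2) g bspec[OF cont that]])
  have "\<exists>\<gamma>\<in>\<Gamma>. U \<inter> X interior_of F \<gamma> \<noteq> {}"
  proof (rule ccontr)
    assume no: "\<not> (\<exists>\<gamma>\<in>\<Gamma>. U \<inter> X interior_of F \<gamma> \<noteq> {})"
    \<comment> \<open>Removing the interiors makes each set nowhere dense in all of
      \<open>X\<close>, so Baire's theorem applies to \<open>X\<close> itself and not to the
      subspace \<open>U\<close>.\<close>
    have "X interior_of \<Union>((\<lambda>\<gamma>. F \<gamma> - X interior_of F \<gamma>) ` \<Gamma>) = {}"
    proof (rule Baire_category_alt)
      show "completely_metrizable_space X \<or> locally_compact_space X \<and> regular_space X"
        using X by (simp add: compact_imp_locally_compact_space compact_Hausdorff_imp_regular_space)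
      show "countable ((\<lambda>\<gamma>. F \<gamma> - X interior_of F \<gamma>) ` \<Gamma>)" using \<Gamma> by simp
      fix T assume "T \<in> (\<lambda>\<gamma>. F \<gamma> - X interior_of F \<gamma>) ` \<Gamma>"
      then obtain \<gamma> where \<gamma>: "\<gamma> \<in> \<Gamma>" "T = F \<gamma> - X interior_of F \<gamma>" by blast
      have "X interior_of T \<subseteq> X interior_of F \<gamma>"
        unfolding \<gamma>(2) by (rule interior_of_mono) blast
      moreover have "X interior_of T \<subseteq> T" by (rule interior_of_subset)
      ultimately have "X interior_of T = {}" unfolding \<gamma>(2) by blast
      then show "closedin X T \<and> X interior_of T = {}"
        using closed[OF \<gamma>(1)] by (simp add: \<gamma>(2) closedin_diff)
    qed
    moreover have "U \<subseteq> X interior_of \<Union>((\<lambda>\<gamma>. F \<gamma> - X interior_of F \<gamma>) ` \<Gamma>)"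
    proof (rule interior_of_maximal[OF _ U(1)], rule)
      fix x assume x: "x \<in> U"
      then have xX: "x \<in> topspace X" using openin_subset[OF U(1)] by blast
      then obtain \<gamma> where "\<gamma> \<in> \<Gamma>" "g x = \<gamma> x" using pointwise by blast
      then show "x \<in> \<Union>((\<lambda>\<gamma>. F \<gamma> - X interior_of F \<gamma>) ` \<Gamma>)"
        using no x xX unfolding F_def by blast
    qed
    ultimately show False using U(2) by blast
  qed
  then obtain \<gamma> where \<gamma>: "\<gamma> \<in> \<Gamma>" "U \<inter> X interior_of F \<gamma> \<noteq> {}" by blast
  have "openin X (U \<inter> X interior_of F \<gamma>)" using U(1) by (simp add: openin_Int)
  moreover have "g x = \<gamma> x" if "x \<in> U \<inter> X interior_of F \<gamma>" for x
    using that interior_of_subset[of X "F \<gamma>"] by (auto simp: F_def)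
  ultimately show thesis using that \<gamma> by blast
qed

lemma Diff_continuous_map: "g \<in> Diff r M \<Longrightarrow> continuous_map (mtop M) (mtop M) g"
  using Ck_map_continuous[OF Ck_diffeoD(4)[OF Diff_memD(2)]] by simp

text \<open>Along the moving frame, \<omega> of the frame and \<omega> of its image under
  \<open>g\<close> both vary continuously. They agree at every parameter near whose image
  \<open>g\<close> is given by a single element of \<Gamma>, and such parameters accumulate at the
  origin.\<close>

lemma pointwise_agreement_preserves_structure:
  assumes M: "smooth_manifold M" and comp: "compact_space (mtop M)" and k: "k \<le> r"
    and V: "Hausdorff_space (mtop V)" and \<omega>: "continuous_map (frame_bundle k M) (mtop V) \<omega>"
    and \<Gamma>: "countable \<Gamma>" "\<Gamma> \<subseteq> Aut_struct r M k \<omega>" and g: "g \<in> Diff r M"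
    and pointwise: "\<forall>x \<in> mpoints M. \<exists>\<gamma>\<in>\<Gamma>. g x = \<gamma> x"
  shows "g \<in> Aut_struct r M k \<omega>"
proof -
  let ?E = "Euclidean_space (mdim M)"
  have Hausdorff: "Hausdorff_space (mtop M)" using M by (simp add: smooth_manifold_def)
  have \<Gamma>_Diff: "\<gamma> \<in> Diff r M" if "\<gamma> \<in> \<Gamma>" for \<gamma>
    using that \<Gamma>(2) by (auto simp: Aut_struct_def)
  then have cont: "\<forall>\<gamma>\<in>\<Gamma>. continuous_map (mtop M) (mtop M) \<gamma>" using Diff_continuous_map by blast
  have "\<omega> (prolong k M g p) = \<omega> p" if "p \<in> frames k M" for p
  proof -
    obtain \<phi> where \<phi>: "\<phi> \<in> local_params k M" "p = frame_of k M \<phi>"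
      using framesE[OF \<open>p \<in> frames k M\<close>] .
    obtain W S where W: "origin \<in> W" "Ck_diffeo k (Rn (mdim M)) W M S \<phi>"
      using local_paramsE[OF \<phi>(1)] .
    note g\<phi> = Diff_compose_param[OF M g k W(2)]
    have oW: "openin ?E W" using Ck_map_openin[OF Ck_diffeoD(4)[OF W(2)]] by simp
    \<comment> \<open>Agreement is demanded on a neighbourhood of \<open>\<phi> t\<close>, since
      jets at \<open>\<phi> t\<close> are not determined by the value there.\<close>
    define D where "D = {t \<in> W. \<exists>\<gamma>\<in>\<Gamma>. \<exists>U. openin (mtop M) U \<and> \<phi> t \<in> U \<and> (\<forall>x\<in>U. g x = \<gamma> x)}"
    define P where "P t = frame_of k M (\<lambda>y. \<phi> (\<lambda>i. y i + t i))" for t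
    \<comment> \<open>\<open>Q\<close> is the moving frame of the parametrisation
      \<open>g \<circ> \<phi>\<close>, so its continuity comes from the same lemma as that of
      \<open>P\<close>.\<close>
    define Q where "Q t = frame_of k M (\<lambda>y. g (\<phi> (\<lambda>i. y i + t i)))" for t
    have "continuous_map (subtopology ?E W) (frame_bundle k M) P"
      unfolding P_def by (rule continuous_map_moving_frame[OF M W(2)])
    then have contP: "continuous_map (subtopology ?E W) (mtop V) (\<lambda>t. \<omega> (P t))"
      using continuous_map_compose[OF _ \<omega>] by (fastforce simp: o_def)
    have "continuous_map (subtopology ?E W) (frame_bundle k M) Q"
      unfolding Q_def by (rule continuous_map_moving_frame[OF M g\<phi>])
    then have contQ: "continuous_map (subtopology ?E W) (mtop V) (\<lambda>t. \<omega> (Q t))"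
      using continuous_map_compose[OF _ \<omega>] by (fastforce simp: o_def)
    have PQ: "\<omega> (Q t) = \<omega> (P t)" if tD: "t \<in> D" for t
    proof -
      obtain \<gamma> U where t: "t \<in> W" and \<gamma>: "\<gamma> \<in> \<Gamma>" and U: "openin (mtop M) U" "\<phi> t \<in> U" "\<And>x. x \<in> U \<Longrightarrow> g x = \<gamma> x"
        using tD unfolding D_def by blast
      define \<psi> where "\<psi> = (\<lambda>y. \<phi> (\<lambda>i. y i + t i))"
      have lp: "\<psi> \<in> local_params k M"
        unfolding \<psi>_def by (rule local_params_translate[OF M W(2) t])
      obtain W' S' where W': "origin \<in> W'" "Ck_diffeo k (Rn (mdim M)) W' M S' \<psi>"
        using local_paramsE[OF lp] .
      have "openin ?E {y \<in> W'. \<psi> y \<in> U}"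
        using Ck_map_preimage_openin[OF Ck_diffeoD(4)[OF W'(2)] U(1)] by simp
      moreover have "origin \<in> {y \<in> W'. \<psi> y \<in> U}" using W'(1) U(2) by (simp add: \<psi>_def)
      ultimately have "frame_of k M (\<lambda>y. g (\<psi> y)) = frame_of k M (\<lambda>y. \<gamma> (\<psi> y))"
        using U(3)
        by (intro frame_of_eq_local[where B = "{y \<in> W'. \<psi> y \<in> U}", OF Diff_compose_local_params[OF M g k lp]
              Diff_compose_local_params[OF M \<Gamma>_Diff[OF \<gamma>] k lp]]) auto
      also have "\<dots> = prolong k M \<gamma> (frame_of k M \<psi>)"
        by (rule prolong_frame_of[OF M \<Gamma>_Diff[OF \<gamma>] k lp, symmetric])
      finally have "Q t = prolong k M \<gamma> (P t)" by (simp add: P_def Q_def \<psi>_def)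
      moreover have "P t \<in> frames k M"
        using frame_of_in_frames[OF lp] by (simp add: P_def \<psi>_def)
      ultimately show ?thesis using \<gamma> \<Gamma>(2) by (auto simp: Aut_struct_def)
    qed
    have "origin \<in> subtopology ?E W closure_of D"
      unfolding in_closure_of
    proof (intro conjI allI impI)
      show "origin \<in> topspace (subtopology ?E W)" using W(1) openin_subset[OF oW] by auto
      fix B assume "origin \<in> B \<and> openin (subtopology ?E W) B"
      then have B: "origin \<in> B" "openin ?E B" "B \<subseteq> W"
        using oW by (auto simp: openin_open_subtopology)
      \<comment> \<open>Open sets of parameters have open images under the local diffeomorphism
        \<open>\<phi>\<close>, which transfers the Baire argument from \<open>M\<close> to parameter
        space.\<close>
      have "openin (mtop M) (\<phi> ` B)"
        using B by (intro Ck_diffeo_image_openin[OF W(2)]) simp_all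
      moreover have "\<phi> ` B \<noteq> {}" using B(1) by blast
      ultimately obtain \<gamma> U where U: "\<gamma> \<in> \<Gamma>" "openin (mtop M) U" "U \<noteq> {}" "U \<subseteq> \<phi> ` B"
        "\<forall>x\<in>U. g x = \<gamma> x"
        by (rule pointwise_agreement_dense[OF comp Hausdorff \<Gamma>(1) cont Diff_continuous_map[OF g] pointwise])
      then obtain t where "t \<in> B" "\<phi> t \<in> U" by blast
      then have "t \<in> D" using B(3) U unfolding D_def by blast
      then show "\<exists>t. t \<in> D \<and> t \<in> B" using \<open>t \<in> B\<close> by blast
    qed
    from forall_in_closure_of_eq[OF this V contQ contP PQ]
    have "\<omega> (Q origin) = \<omega> (P origin)" .
    moreover have "P origin = p" by (simp add: P_def \<phi>(2))
    moreover have "Q origin = prolong k M g p"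
      using prolong_frame_of[OF M g k \<phi>(1)] by (simp add: Q_def \<phi>(2))
    ultimately show ?thesis by simp
  qed
  then show ?thesis using g by (simp add: Aut_struct_def)
qed

subsection \<open>Conjugation in the group of diffeomorphisms\<close>

lemma group_Diff_group: "smooth_manifold M \<Longrightarrow> group (Diff_group r M)"
  unfolding Diff_group_def using subgroup.subgroup_is_group[OF subgroup_Diff group_BijGroup] .

lemma Diff_group_simps:
  "carrier (Diff_group r M) = Diff r M"
  "\<one>\<^bsub>Diff_group r M\<^esub> = (\<lambda>x\<in>mpoints M. x)"
  by (simp_all add: Diff_group_def BijGroup_def)

lemma Diff_group_mult_apply:
  "f \<in> Diff r M \<Longrightarrow> g \<in> Diff r M \<Longrightarrow> x \<in> mpoints M \<Longrightarrow> (f \<otimes>\<^bsub>Diff_group r M\<^esub> g) x = f (g x)"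
  by (simp add: Diff_group_def BijGroup_def Diff_memD(1) compose_eq)

lemma Diff_apply_in: "f \<in> Diff r M \<Longrightarrow> x \<in> mpoints M \<Longrightarrow> f x \<in> mpoints M"
  using Diff_memD(3) bij_betwE by blast

lemma Diff_group_inv_apply:
  assumes M: "smooth_manifold M" and f: "f \<in> Diff r M" and x: "x \<in> mpoints M"
  shows "inv\<^bsub>Diff_group r M\<^esub> f \<in> Diff r M"
    and "(inv\<^bsub>Diff_group r M\<^esub> f) (f x) = x" and "f ((inv\<^bsub>Diff_group r M\<^esub> f) x) = x"
proof -
  interpret group "Diff_group r M" by (rule group_Diff_group[OF M])
  show i: "inv\<^bsub>Diff_group r M\<^esub> f \<in> Diff r M"
    using inv_closed[of f] f by (simp add: Diff_group_simps)
  show "(inv\<^bsub>Diff_group r M\<^esub> f) (f x) = x"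
    using Diff_group_mult_apply[OF i f x] l_inv[of f] f x by (simp add: Diff_group_simps)
  show "f ((inv\<^bsub>Diff_group r M\<^esub> f) x) = x"
    using Diff_group_mult_apply[OF f i x] r_inv[of f] f x by (simp add: Diff_group_simps)
qed

lemma (in group) conjugate_hom:
  assumes "f \<in> carrier G" and "a \<in> carrier G" and "b \<in> carrier G"
  shows "f \<otimes> (a \<otimes> b) \<otimes> inv f = (f \<otimes> a \<otimes> inv f) \<otimes> (f \<otimes> b \<otimes> inv f)"
proof -
  have "inv f \<otimes> (f \<otimes> (b \<otimes> inv f)) = b \<otimes> inv f"
    using assms by (simp add: m_assoc[symmetric])
  then show ?thesis using assms by (simp add: m_assoc)
qed

lemma (in group) conjugate_inv_conjugate:
  assumes "f \<in> carrier G" and "a \<in> carrier G"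
  shows "f \<otimes> (inv f \<otimes> a \<otimes> inv (inv f)) \<otimes> inv f = a"
proof -
  have "f \<otimes> (inv f \<otimes> a) = a" using assms by (simp add: m_assoc[symmetric])
  then show ?thesis using assms by (simp add: m_assoc)
qed

text \<open>The normalizer is defined as a stabilizer for conjugation acting on subsets of the
  carrier; here it is put in elementwise form.\<close>

lemma (in group) mem_normalizer_iff:
  assumes "H \<subseteq> carrier G"
  shows "f \<in> normalizer G H \<longleftrightarrow> f \<in> carrier G \<and> (\<lambda>h. f \<otimes> h \<otimes> inv f) ` H = H"
proof -
  have "f <# H #> inv f = (\<lambda>h. f \<otimes> h \<otimes> inv f) ` H"
    by (auto simp: l_coset_def r_coset_def)
  then show ?thesis
    using assms by (simp add: normalizer_def stabilizer_def)
qed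

text \<open>Stability under conjugation by \<open>f\<close> alone gives only an inclusion, which may
  be proper for infinite \<open>H\<close>. Surjectivity comes from the hypothesis on conjugation by
  \<open>inv f\<close>.\<close>

lemma (in group) conjugation_iso:
  assumes H: "subgroup H G" and f: "f \<in> carrier G"
    and conj: "\<And>h. h \<in> H \<Longrightarrow> f \<otimes> h \<otimes> inv f \<in> H" and conj': "\<And>h. h \<in> H \<Longrightarrow> inv f \<otimes> h \<otimes> inv (inv f) \<in> H"
  shows "(\<lambda>h. f \<otimes> h \<otimes> inv f) \<in> iso (G\<lparr>carrier := H\<rparr>) (G\<lparr>carrier := H\<rparr>)"
proof -
  have HG: "h \<in> carrier G" if "h \<in> H" for h using subgroup.mem_carrier[OF H that] .
  have "inj_on (\<lambda>h. f \<otimes> h \<otimes> inv f) H"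
    by (rule inj_onI) (use f HG in simp)
  moreover have "(\<lambda>h. f \<otimes> h \<otimes> inv f) ` H = H"
  proof
    show "H \<subseteq> (\<lambda>h. f \<otimes> h \<otimes> inv f) ` H"
    proof
      fix h assume "h \<in> H"
      then show "h \<in> (\<lambda>h. f \<otimes> h \<otimes> inv f) ` H"
        using conjugate_inv_conjugate[OF f HG] conj' by (metis image_eqI)
    qed
  qed (use conj in blast)
  moreover have "(\<lambda>h. f \<otimes> h \<otimes> inv f) \<in> hom (G\<lparr>carrier := H\<rparr>) (G\<lparr>carrier := H\<rparr>)"
    by (rule homI) (use conj conjugate_hom[OF f] HG in simp_all)
  ultimately show ?thesis by (simp add: iso_def bij_betw_def)
qed

text \<open>Two orders meet here: \<omega> is preserved at the level of \<open>k\<close>-frames,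
  while freeness concerns \<open>r\<close>-frames. The correction of \<open>g\<close> by an element
  of \<Gamma> is the identity on an open set, so it fixes frames of every order over it to which it
  prolongs, in particular an \<open>r\<close>-frame.\<close>

lemma pointwise_in_group_imp_in_group:
  fixes M :: "'a manifold" and V :: "'v manifold"
  assumes M: "smooth_manifold M" and comp: "compact_space (mtop M)" and k: "k \<le> r"
    and V: "Hausdorff_space (mtop V)" and \<omega>: "continuous_map (frame_bundle k M) (mtop V) \<omega>"
    and free: "\<forall>g \<in> Aut_struct r M k \<omega>. \<forall>p \<in> frames r M. prolong r M g p = p \<longrightarrow> g = \<one>\<^bsub>Diff_group r M\<^esub>"
    and \<Gamma>: "countable \<Gamma>" "subgroup \<Gamma> (Diff_group r M)" "\<Gamma> \<subseteq> Aut_struct r M k \<omega>"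
    and g: "g \<in> Diff r M" and pointwise: "\<forall>x \<in> mpoints M. \<exists>\<gamma>\<in>\<Gamma>. g x = \<gamma> x"
  shows "g \<in> \<Gamma>"
proof (cases "mpoints M = {}")
  case True
  \<comment> \<open>Without points there is no frame on which freeness could be tested;
    extensionality alone leaves only one function.\<close>
  then have "g = \<one>\<^bsub>Diff_group r M\<^esub>"
    using Diff_memD(4)[OF g] by (auto simp: Diff_group_simps extensional_def)
  then show ?thesis using subgroup.one_closed[OF \<Gamma>(2)] by simp
next
  case False
  let ?D = "Diff_group r M"
  interpret D: group ?D by (rule group_Diff_group[OF M])
  have \<Gamma>_Diff: "\<gamma> \<in> Diff r M" if "\<gamma> \<in> \<Gamma>" for \<gamma>
    using that \<Gamma>(3) by (auto simp: Aut_struct_def)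
  then have cont: "\<forall>\<gamma>\<in>\<Gamma>. continuous_map (mtop M) (mtop M) \<gamma>" using Diff_continuous_map by blast
  have "Hausdorff_space (mtop M)" using M by (simp add: smooth_manifold_def)
  then obtain \<gamma> U where \<gamma>: "\<gamma> \<in> \<Gamma>" and U: "openin (mtop M) U" "U \<noteq> {}" "U \<subseteq> mpoints M"
    "\<forall>x\<in>U. g x = \<gamma> x"
    by (rule pointwise_agreement_dense[OF comp _ \<Gamma>(1) cont Diff_continuous_map[OF g] pointwise openin_topspace False])
  define h where "h = inv\<^bsub>?D\<^esub> \<gamma> \<otimes>\<^bsub>?D\<^esub> g"
  have inv: "inv\<^bsub>?D\<^esub> \<gamma> \<in> \<Gamma>" using subgroup.m_inv_closed[OF \<Gamma>(2) \<gamma>] .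
  have h: "h \<in> Diff r M"
    using D.m_closed[of "inv\<^bsub>?D\<^esub> \<gamma>" g] \<Gamma>_Diff[OF inv] g by (simp add: h_def Diff_group_simps)
  have h_apply: "h x = (inv\<^bsub>?D\<^esub> \<gamma>) (g x)" if "x \<in> mpoints M" for x
    unfolding h_def by (rule Diff_group_mult_apply[OF \<Gamma>_Diff[OF inv] g that])
  have "h \<in> Aut_struct r M k \<omega>"
  proof (rule pointwise_agreement_preserves_structure[OF M comp k V \<omega> \<Gamma>(1,3) h], rule)
    fix x assume x: "x \<in> mpoints M"
    then obtain \<delta> where \<delta>: "\<delta> \<in> \<Gamma>" "g x = \<delta> x" using pointwise by blast
    \<comment> \<open>The element \<open>\<delta>\<close> depends on \<open>x\<close> while
      \<open>\<gamma>\<close> is fixed; their quotient still lies in \<Gamma>, so \<open>h\<close>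
      agrees pointwise with \<Gamma>.\<close>
    have "(inv\<^bsub>?D\<^esub> \<gamma> \<otimes>\<^bsub>?D\<^esub> \<delta>) x = h x"
      using Diff_group_mult_apply[OF \<Gamma>_Diff[OF inv] \<Gamma>_Diff[OF \<delta>(1)] x] h_apply[OF x] \<delta>(2) by simp
    then show "\<exists>\<gamma>\<in>\<Gamma>. h x = \<gamma> x"
      using subgroup.m_closed[OF \<Gamma>(2) inv \<delta>(1)] by metis
  qed
  moreover have "\<exists>p \<in> frames r M. prolong r M h p = p"
  proof -
    obtain x where x: "x \<in> U" using U(2) by blast
    then have "x \<in> mpoints M" using openin_subset[OF U(1)] by blast
    then obtain \<phi> where \<phi>: "\<phi> \<in> local_params r M" "\<phi> origin = x"
      using frame_at_point[OF M] by metis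
    obtain W S where W: "origin \<in> W" "Ck_diffeo r (Rn (mdim M)) W M S \<phi>"
      using local_paramsE[OF \<phi>(1)] .
    have "openin (Euclidean_space (mdim M)) {y \<in> W. \<phi> y \<in> U}"
      using Ck_map_preimage_openin[OF Ck_diffeoD(4)[OF W(2)] U(1)] by simp
    moreover have "h z = z" if "z \<in> U" for z
    proof -
      have "z \<in> mpoints M" using that openin_subset[OF U(1)] by blast
      then show ?thesis
        using h_apply bspec[OF U(4) that] Diff_group_inv_apply(2)[OF M \<Gamma>_Diff[OF \<gamma>]] by metis
    qed
    ultimately have "frame_of r M (\<lambda>y. h (\<phi> y)) = frame_of r M \<phi>"
      using W(1) \<phi>(2) x
      by (intro frame_of_eq_local[where B = "{y \<in> W. \<phi> y \<in> U}",
            OF Diff_compose_local_params[OF M h order_refl \<phi>(1)] \<phi>(1)]) simp_all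
    then have "prolong r M h (frame_of r M \<phi>) = frame_of r M \<phi>"
      using prolong_frame_of[OF M h order_refl \<phi>(1)] by simp
    then show ?thesis using frame_of_in_frames[OF \<phi>(1)] by blast
  qed
  ultimately have "h = \<one>\<^bsub>?D\<^esub>" using free by blast
  then have "inv\<^bsub>?D\<^esub> \<gamma> \<otimes>\<^bsub>?D\<^esub> g = \<one>\<^bsub>?D\<^esub>" unfolding h_def .
  moreover have "g \<in> carrier ?D" "\<gamma> \<in> carrier ?D" "inv\<^bsub>?D\<^esub> \<gamma> \<in> carrier ?D"
    using g \<Gamma>_Diff[OF \<gamma>] \<Gamma>_Diff[OF inv] by (simp_all only: Diff_group_simps(1))
  ultimately have "g = \<gamma>" by (metis D.inv_equality D.inv_inv)
  then show ?thesis using \<gamma> by simp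
qed

theorem corollary2p6:
  fixes M :: "'a manifold" and V :: "'v manifold"
    and G :: "('g, 'b) monoid_scheme" and \<rho> :: "'g \<Rightarrow> 'a \<Rightarrow> 'a"
    and k r :: nat
    and act :: "((nat \<Rightarrow> real) \<Rightarrow> (nat \<Rightarrow> real)) set \<Rightarrow> 'v \<Rightarrow> 'v"
    and \<omega> :: "((nat \<Rightarrow> real) \<Rightarrow> 'a) set \<Rightarrow> 'v"
  assumes "smooth_manifold M" and "compact_space (mtop M)"
    and "group_action G (mpoints M) \<rho>" and "countable (carrier G)"
    and "\<forall>g \<in> carrier G. \<rho> g \<in> Diff r M"
    and "k \<le> r" and "geometric_structure M k V act \<omega>"
    and "rigid_structure r M k \<omega>"
    and "\<forall>g \<in> carrier G. \<rho> g \<in> Aut_struct r M k \<omega>"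
  defines "\<Gamma> \<equiv> \<rho> ` carrier G"
  shows "(\<forall>f \<in> Aut_orbits r M G \<rho>.
            \<exists>\<phi> \<in> iso ((Diff_group r M)\<lparr>carrier := \<Gamma>\<rparr>) ((Diff_group r M)\<lparr>carrier := \<Gamma>\<rparr>).
              \<forall>\<gamma> \<in> \<Gamma>. \<forall>x \<in> mpoints M. f (\<gamma> x) = \<phi> \<gamma> (f x)) \<and>
         Aut_orbits r M G \<rho> = normalizer (Diff_group r M) \<Gamma>"
proof -
  let ?D = "Diff_group r M"
  let ?X = "mpoints M"
  note M = assms(1)
  interpret D: group ?D by (rule group_Diff_group[OF M])
  \<comment> \<open>Equivariance forces the automorphism attached to \<open>f\<close> to be
    conjugation by \<open>f\<close>.\<close>
  define conj where "conj f \<gamma> = f \<otimes>\<^bsub>?D\<^esub> \<gamma> \<otimes>\<^bsub>?D\<^esub> inv\<^bsub>?D\<^esub> f" for f \<gamma>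
  have \<Gamma>_Diff: "\<gamma> \<in> Diff r M" if "\<gamma> \<in> \<Gamma>" for \<gamma>
    using that assms(5) by (auto simp: \<Gamma>_def)
  \<comment> \<open>The action takes values in the group of all bijections. Its image is a subgroup
    there, and it lies in \<open>Diff r M\<close>, whose group structure is inherited.\<close>
  have "subgroup \<Gamma> (BijGroup ?X)"
    unfolding \<Gamma>_def by (rule group_hom.img_is_subgroup[OF group_action.group_hom[OF assms(3)]])
  then have \<Gamma>: "subgroup \<Gamma> ?D"
    unfolding Diff_group_def using \<Gamma>_Diff by (intro group.subgroup_incl[OF group_BijGroup _ subgroup_Diff[OF M]]) auto
  have orbit: "y \<in> orbit G \<rho> x \<longleftrightarrow> (\<exists>\<gamma>\<in>\<Gamma>. y = \<gamma> x)" for x y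
    by (auto simp: orbit_def \<Gamma>_def)
  have inv_Diff: "inv\<^bsub>?D\<^esub> f \<in> Diff r M" if "f \<in> Diff r M" for f
    using D.inv_closed[of f] that by (simp add: Diff_group_simps)
  have conj_apply: "conj f \<gamma> x = f (\<gamma> ((inv\<^bsub>?D\<^esub> f) x))"
    if "f \<in> Diff r M" "\<gamma> \<in> Diff r M" "x \<in> ?X" for f \<gamma> x
  proof -
    have "f \<otimes>\<^bsub>?D\<^esub> \<gamma> \<in> Diff r M"
      using D.m_closed[of f \<gamma>] that by (simp add: Diff_group_simps)
    then show ?thesis
      unfolding conj_def using that inv_Diff[OF that(1)]
      by (simp add: Diff_group_mult_apply Diff_apply_in)
  qed
  \<comment> \<open>This is formal for every diffeomorphism \<open>f\<close>; preservation of orbits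
    enters only through the fact that \<open>conj f\<close> maps \<Gamma> into itself.\<close>
  have equivariant: "f (\<gamma> x) = conj f \<gamma> (f x)" if "f \<in> Diff r M" "\<gamma> \<in> \<Gamma>" "x \<in> ?X" for f \<gamma> x
    using conj_apply[OF that(1) \<Gamma>_Diff[OF that(2)] Diff_apply_in[OF that(1,3)]]
      Diff_group_inv_apply(2)[OF M that(1,3)] by simp
  have in_group: "g \<in> \<Gamma>" if "g \<in> Diff r M" "\<forall>x \<in> ?X. \<exists>\<gamma>\<in>\<Gamma>. g x = \<gamma> x" for g
  proof (rule pointwise_in_group_imp_in_group[OF M assms(2,6) _ _ _ _ \<Gamma> _ that])
    show "Hausdorff_space (mtop V)" "continuous_map (frame_bundle k M) (mtop V) \<omega>"
      using assms(7) by (simp_all add: geometric_structure_def smooth_manifold_def)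
    show "\<forall>g \<in> Aut_struct r M k \<omega>. \<forall>p \<in> frames r M. prolong r M g p = p \<longrightarrow> g = \<one>\<^bsub>?D\<^esub>"
      using assms(8) by (simp add: rigid_structure_def)
    show "countable \<Gamma>" "\<Gamma> \<subseteq> Aut_struct r M k \<omega>"
      using assms(4,9) by (auto simp: \<Gamma>_def)
  qed
  have conj_in: "conj f \<gamma> \<in> \<Gamma>" if f: "f \<in> Aut_orbits r M G \<rho>" and \<gamma>: "\<gamma> \<in> \<Gamma>" for f \<gamma>
  proof (rule in_group[OF _ ballI])
    have fD: "f \<in> Diff r M" using f by (simp add: Aut_orbits_def)
    show "conj f \<gamma> \<in> Diff r M"
      using D.m_closed[OF D.m_closed D.inv_closed, of f \<gamma> f] fD \<Gamma>_Diff[OF \<gamma>] by (simp add: conj_def Diff_group_simps)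
    fix x assume x: "x \<in> ?X"
    \<comment> \<open>For \<open>y\<close> with \<open>f y = x\<close>, the point
      \<open>\<gamma> y\<close> lies in the orbit of \<open>y\<close>, so
      \<open>f (\<gamma> y) = conj f \<gamma> x\<close> lies in the orbit of \<open>x\<close>. Thus
      the conjugate agrees with some element of \<Gamma> at each point.\<close>
    define y where "y = (inv\<^bsub>?D\<^esub> f) x"
    have y: "y \<in> ?X" "f y = x"
      using Diff_apply_in[OF inv_Diff[OF fD] x] Diff_group_inv_apply(3)[OF M fD x] by (simp_all add: y_def)
    have "f (\<gamma> y) \<in> orbit G \<rho> (f y)"
      using f y(1) \<gamma> Diff_apply_in[OF \<Gamma>_Diff[OF \<gamma>] y(1)] orbit unfolding Aut_orbits_def by blast
    then show "\<exists>\<delta>\<in>\<Gamma>. conj f \<gamma> x = \<delta> x"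
      using conj_apply[OF fD \<Gamma>_Diff[OF \<gamma>] x] y(2) orbit by (simp add: y_def)
  qed
  \<comment> \<open>Applied to the inverse, \<open>conj_in\<close> supplies the reverse inclusion,
    so that conjugation by \<open>f\<close> maps \<Gamma> onto itself.\<close>
  have inv_Aut: "inv\<^bsub>?D\<^esub> f \<in> Aut_orbits r M G \<rho>" if f: "f \<in> Aut_orbits r M G \<rho>" for f
  proof -
    have fD: "f \<in> Diff r M" using f by (simp add: Aut_orbits_def)
    have "y \<in> orbit G \<rho> x \<longleftrightarrow> (inv\<^bsub>?D\<^esub> f) y \<in> orbit G \<rho> ((inv\<^bsub>?D\<^esub> f) x)" if "x \<in> ?X" "y \<in> ?X" for x y
    proof -
      have "(inv\<^bsub>?D\<^esub> f) x \<in> ?X" "(inv\<^bsub>?D\<^esub> f) y \<in> ?X"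
        using Diff_apply_in[OF inv_Diff[OF fD]] that by simp_all
      then have "(inv\<^bsub>?D\<^esub> f) y \<in> orbit G \<rho> ((inv\<^bsub>?D\<^esub> f) x)
          \<longleftrightarrow> f ((inv\<^bsub>?D\<^esub> f) y) \<in> orbit G \<rho> (f ((inv\<^bsub>?D\<^esub> f) x))"
        using f by (simp add: Aut_orbits_def)
      then show ?thesis using Diff_group_inv_apply(3)[OF M fD] that by simp
    qed
    then show ?thesis using inv_Diff[OF fD] by (simp add: Aut_orbits_def)
  qed
  have conj_iso: "conj f \<in> iso (?D\<lparr>carrier := \<Gamma>\<rparr>) (?D\<lparr>carrier := \<Gamma>\<rparr>)" if f: "f \<in> Aut_orbits r M G \<rho>" for f
    unfolding conj_def
    using f conj_in[OF f] conj_in[OF inv_Aut[OF f]]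
    by (intro D.conjugation_iso[OF \<Gamma>]) (simp_all add: conj_def Aut_orbits_def Diff_group_simps)
  have "\<exists>\<phi> \<in> iso (?D\<lparr>carrier := \<Gamma>\<rparr>) (?D\<lparr>carrier := \<Gamma>\<rparr>). \<forall>\<gamma> \<in> \<Gamma>. \<forall>x \<in> ?X. f (\<gamma> x) = \<phi> \<gamma> (f x)"
    if f: "f \<in> Aut_orbits r M G \<rho>" for f
    using conj_iso[OF f] equivariant[of f] f by (intro bexI[of _ "conj f"]) (auto simp: Aut_orbits_def)
  moreover have "f \<in> Aut_orbits r M G \<rho> \<longleftrightarrow> f \<in> normalizer ?D \<Gamma>" for f
  proof
    assume f: "f \<in> Aut_orbits r M G \<rho>"
    have "conj f ` \<Gamma> = \<Gamma>" using conj_iso[OF f] by (simp add: iso_def bij_betw_def)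
    then show "f \<in> normalizer ?D \<Gamma>"
      using f subgroup.subset[OF \<Gamma>] by (simp add: D.mem_normalizer_iff conj_def[abs_def] Aut_orbits_def Diff_group_simps)
  next
    assume "f \<in> normalizer ?D \<Gamma>"
    then have f: "f \<in> Diff r M" and im: "conj f ` \<Gamma> = \<Gamma>"
      using subgroup.subset[OF \<Gamma>] by (simp_all add: D.mem_normalizer_iff conj_def[abs_def] Diff_group_simps)
    \<comment> \<open>One direction uses that \<open>conj f\<close> maps \<Gamma> into \<Gamma>. The
      other writes a given \<open>\<delta>\<close> as \<open>conj f \<gamma>\<close>, by
      surjectivity, and cancels the injective \<open>f\<close>.\<close>
    have "y \<in> orbit G \<rho> x \<longleftrightarrow> f y \<in> orbit G \<rho> (f x)" if xy: "x \<in> ?X" "y \<in> ?X" for x y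
    proof
      assume "y \<in> orbit G \<rho> x"
      then obtain \<gamma> where "\<gamma> \<in> \<Gamma>" "y = \<gamma> x" using orbit by blast
      then show "f y \<in> orbit G \<rho> (f x)" using equivariant[OF f _ xy(1)] im orbit by blast
    next
      assume "f y \<in> orbit G \<rho> (f x)"
      then obtain \<delta> where \<delta>: "\<delta> \<in> \<Gamma>" "f y = \<delta> (f x)" using orbit by blast
      then have "\<delta> \<in> conj f ` \<Gamma>" using im by simp
      then obtain \<gamma> where \<gamma>: "\<gamma> \<in> \<Gamma>" "f y = conj f \<gamma> (f x)" using \<delta>(2) by blast
      then have "f y = f (\<gamma> x)" using equivariant[OF f _ xy(1)] by simp
      moreover have "inj_on f ?X" using Diff_memD(3)[OF f] by (simp add: bij_betw_def)
      ultimately have "y = \<gamma> x"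
        using xy Diff_apply_in[OF \<Gamma>_Diff[OF \<gamma>(1)] xy(1)] by (simp add: inj_on_eq_iff)
      then show "y \<in> orbit G \<rho> x" using \<gamma>(1) orbit by blast
    qed
    then show "f \<in> Aut_orbits r M G \<rho>" using f by (simp add: Aut_orbits_def)
  qed
  ultimately show ?thesis by blast
qed

end
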